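(* Let $d\ge2$, $\rho\in[0,1)$, $Q=(q_{ij})\in O(d)$, and let $(U_j,V_j)$, $j=1,\dots,n$, be i.i.d. random vectors on $S^{d-1}\times S^{d-1}$ each with density $$c(u,v)=\frac{1}{A_{d-1}^2}\,\frac{1-\rho^2}{(1-2\rho\,u'Qv+\rho^2)^{d/2}}.$$ Define the estimator $\widehat{\rho Q}=\frac{d}{n}\sum_{j=1}^n U_jV_j'$. Then: (i) $\widehat{\rho Q}$ is an unbiased and consistent estimator of $\rho Q$; (ii) letting $g$ map a $d\times d$ matrix $A=(a_1,\dots,a_d)$ (columns $a_k$) to the vector $g(A)=(a_1',\dots,a_d')'\in\mathbb{R}^{d^2}$, we have $\sqrt n\{g(\widehat{\rho Q})-g(\rho Q)\}\xrightarrow{d} N(0,\Sigma)$ as $n\to\infty$, where $\Sigma=(\sigma_{mn})$ is given, for $m=d(j-1)+i$ and $n=d(l-1)+k$ with $1\le i,j,k,l\le d$, by $$\sigma_{mn}=\begin{cases}1+\dfrac{\rho^2}{d+2}\{(d-2)q_{ij}^2-2\}, & m=n,\\[2mm] \dfrac{\rho^2}{d+2}(d\,q_{kj}q_{il}-2q_{ij}q_{kl}), & \text{otherwise.}\end{cases}$$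
   Context: $S^{d-1}=\{x\in\mathbb{R}^d:\|x\|=1\}$, $x'$ denotes transpose, $O(d)$ is the group of $d\times d$ orthogonal matrices, and $A_{d-1}=2\pi^{d/2}/\Gamma(d/2)$. The paper writes the estimator as $\hat\rho\hat Q$. *)

theory Defs
  imports "HOL-Probability.Probability"
begin

text \<open>Surface (Hausdorff) measure on the unit sphere S^{d-1} in R^d, realised as the
  cone measure: sigma(B) = d * vol({t x : x in B, 0 < t <= 1}), i.e. the image of
  d times Lebesgue measure on the open unit ball under x -> x/|x|.
  Its total mass is d * vol(B^d) = A_{d-1}.\<close>
definition sphere_surface :: "(real^'d) measure" where
  "sphere_surface =
     distr (density lborel (\<lambda>x. ennreal (real CARD('d)) * indicator (ball 0 1) x))
           borel (\<lambda>x. sgn x)"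

definition sphere_area :: "nat \<Rightarrow> real" where
  "sphere_area d = 2 * pi powr (real d / 2) / Gamma (real d / 2)"

definition cdens :: "real \<Rightarrow> real^'d^'d \<Rightarrow> real^'d \<Rightarrow> real^'d \<Rightarrow> real" where
  "cdens \<rho> Q u v =
     (1 / (sphere_area CARD('d))\<^sup>2) *
     ((1 - \<rho>\<^sup>2) / (1 - 2 * \<rho> * (u \<bullet> (Q *v v)) + \<rho>\<^sup>2) powr (real CARD('d) / 2))"

definition outer :: "real^'d \<Rightarrow> real^'d \<Rightarrow> real^'d^'d" where
  "outer u v = (\<chi> i k. u $ i * v $ k)"

definition rhoQ_hat :: "(nat \<Rightarrow> 's \<Rightarrow> real^'d) \<Rightarrow> (nat \<Rightarrow> 's \<Rightarrow> real^'d) \<Rightarrow> nat \<Rightarrow> 's \<Rightarrow> real^'d^'d" where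
  "rhoQ_hat U V n \<omega> = (real CARD('d) / real n) *\<^sub>R (\<Sum>j<n. outer (U j \<omega>) (V j \<omega>))"

text \<open>vec operator g: stacks columns; the entry in row i, column j of A is the
  coordinate with index (i,j) (which is position m = d(j-1)+i in the paper's ordering).\<close>
definition gvec :: "real^'d^'d \<Rightarrow> real^('d \<times> 'd)" where
  "gvec A = (\<chi> p. A $ fst p $ snd p)"

definition Sigma_mat :: "real \<Rightarrow> real^'d^'d \<Rightarrow> real^('d \<times> 'd)^('d \<times> 'd)" where
  "Sigma_mat \<rho> Q = (\<chi> m n.
     (let d = real CARD('d); i = fst m; j = snd m; k = fst n; l = snd n in
      if (i, j) = (k, l)
      then 1 + \<rho>\<^sup>2 / (d + 2) * ((d - 2) * (Q $ i $ j)\<^sup>2 - 2)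
      else \<rho>\<^sup>2 / (d + 2) * (d * (Q $ k $ j) * (Q $ i $ l) - 2 * (Q $ i $ j) * (Q $ k $ l))))"

text \<open>N is the (possibly degenerate) multivariate normal distribution N(0, S):
  a probability measure on the Borel sets with characteristic function exp(-t'St/2).\<close>
definition is_normal_0 :: "('k::euclidean_space) measure \<Rightarrow> ('k \<Rightarrow> 'k) \<Rightarrow> bool" where
  "is_normal_0 N S \<longleftrightarrow> prob_space N \<and> sets N = sets borel \<and>
     (\<forall>t. (\<integral>x. cis (t \<bullet> x) \<partial>N) = complex_of_real (exp (- (t \<bullet> S t) / 2)))"

definition conv_in_distr :: "'s measure \<Rightarrow> (nat \<Rightarrow> 's \<Rightarrow> 'k::euclidean_space) \<Rightarrow> 'k measure \<Rightarrow> bool" where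
  "conv_in_distr M X N \<longleftrightarrow>
     (\<forall>f::'k \<Rightarrow> real. continuous_on UNIV f \<and> bounded (range f) \<longrightarrow>
        ((\<lambda>n. \<integral>\<omega>. f (X n \<omega>) \<partial>M) \<longlonglongrightarrow> (\<integral>x. f x \<partial>N)))"

end

theory Submission
  imports Defs
begin

text \<open>
  Given \<open>V = v\<close>, the density of \<open>U\<close> is the Poisson kernel of the unit ball at the interior point
  \<open>\<rho> Q v\<close>, so conditional expectations of polynomials in \<open>U\<close> are values of their harmonic extensions:
  \<open>E(U | V) = \<rho> Q V\<close> and \<open>E(U U' | V) = \<rho>\<^sup>2 (Q V)(Q V)' + (1 - \<rho>\<^sup>2)/d I\<close>. Together with the moments of
  order two and four of the uniform distribution of \<open>V\<close> this gives mean and covariance of \<open>U V'\<close>.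
  The zonal integrals needed come from rotation invariance alone: reflections reduce everything to
  functions of \<open>u \<bullet> e\<close>, and rotations in a plane yield an integration by parts formula.

  The multivariate limit theorem follows from the univariate one through characteristic functions.
  Convergence of characteristic functions passes to bounded continuous functions by approximating
  them with trigonometric polynomials, tightness being immediate from the second moments; the normal
  limit is a linear image of independent standard normals, its covariance form being a sum of squares.
\<close>

section \<open>Convergence in distribution from characteristic functions\<close>

inductive trig_poly :: "('k::euclidean_space \<Rightarrow> complex) \<Rightarrow> bool" where
  cis: "trig_poly (\<lambda>x. cis (t \<bullet> x))"
| scale: "trig_poly f \<Longrightarrow> trig_poly (\<lambda>x. c * f x)"
| add: "trig_poly f \<Longrightarrow> trig_poly g \<Longrightarrow> trig_poly (\<lambda>x. f x + g x)"

lemma trig_poly_mult: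
  assumes "trig_poly f" "trig_poly g"
  shows "trig_poly (\<lambda>x. f x * g x)"
  using assms(1)
proof (induction rule: trig_poly.induct)
  case (cis t)
  show ?case
    using assms(2)
  proof (induction rule: trig_poly.induct)
    case (cis u)
    have "(\<lambda>x. cis (t \<bullet> x) * cis (u \<bullet> x)) = (\<lambda>x. cis ((t + u) \<bullet> x))"
      by (simp add: cis_mult inner_add_left)
    then show ?case by (metis trig_poly.cis)
  next
    case (scale f c)
    then show ?case
      using trig_poly.scale[of _ c] by (simp add: mult.left_commute)
  next
    case (add f g)
    then show ?case by (simp add: distrib_left trig_poly.add)
  qed
next
  case (scale f c)
  then show ?case using trig_poly.scale[of _ c] by (simp add: mult.assoc)
next
  case (add f g)
  then show ?case by (simp add: distrib_right trig_poly.add)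
qed

lemma trig_poly_const: "trig_poly (\<lambda>x. c)"
  using trig_poly.scale[OF trig_poly.cis[of 0], of c] by simp

lemma trig_poly_sum:
  assumes "finite I" "\<And>i. i \<in> I \<Longrightarrow> trig_poly (f i)"
  shows "trig_poly (\<lambda>x. \<Sum>i\<in>I. f i x)"
  using assms by (induction I rule: finite_induct) (auto intro: trig_poly_const trig_poly.add)

lemma trig_poly_sin: "trig_poly (\<lambda>x. complex_of_real (sin (t \<bullet> x)))"
proof -
  have "trig_poly (\<lambda>x. (- \<i> / 2) * cis (t \<bullet> x) + (\<i> / 2) * cis ((- t) \<bullet> x))"
    by (intro trig_poly.intros)
  also have "(\<lambda>x. (- \<i> / 2) * cis (t \<bullet> x) + (\<i> / 2) * cis ((- t) \<bullet> x))
      = (\<lambda>x. complex_of_real (sin (t \<bullet> x)))"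
    by (auto simp: complex_eq_iff)
  finally show ?thesis .
qed

lemma trig_poly_polynomial_sin:
  fixes p :: "'k::euclidean_space \<Rightarrow> real"
  assumes "real_polynomial_function p"
  shows "trig_poly (\<lambda>x. complex_of_real (p (\<Sum>b\<in>Basis. sin ((x \<bullet> b) / L) *\<^sub>R b)))"
  using assms
proof (induction rule: real_polynomial_function.induct)
  case (linear f)
  interpret bounded_linear f by fact
  have "trig_poly (\<lambda>x. \<Sum>b\<in>Basis. complex_of_real (f b) * complex_of_real (sin ((b /\<^sub>R L) \<bullet> x)))"
    by (intro trig_poly_sum trig_poly.scale trig_poly_sin) simp
  then show ?case
    by (simp add: sum scaleR inner_commute divide_inverse mult.commute)
next
  case (const c)
  then show ?case by (rule trig_poly_const)
next
  case (add f g)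
  then show ?case by (simp add: trig_poly.add)
next
  case (mult f g)
  then show ?case by (simp add: trig_poly_mult)
qed

lemma trig_poly_bounded_measurable:
  assumes "trig_poly f"
  shows "(\<exists>B. \<forall>x. norm (f x) \<le> B) \<and> f \<in> borel_measurable borel"
  using assms
proof (induction rule: trig_poly.induct)
  case (cis t)
  have "continuous_on UNIV (\<lambda>x. cis (t \<bullet> x))" by (intro continuous_intros)
  then show ?case by (auto intro!: exI[of _ 1] borel_measurable_continuous_onI)
next
  case (scale f c)
  then obtain B where "\<And>x. norm (f x) \<le> B" by blast
  then have "norm (c * f x) \<le> norm c * B" for x
    by (simp add: norm_mult mult_left_mono)
  with scale show ?case by auto
next
  case (add f g)
  then obtain B C where "\<And>x. norm (f x) \<le> B" "\<And>x. norm (g x) \<le> C" by blast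
  then have "norm (f x + g x) \<le> B + C" for x
    by (meson norm_triangle_mono)
  with add show ?case by auto
qed

lemma trig_poly_integrable:
  assumes "finite_measure M" "X \<in> borel_measurable M" "trig_poly f"
  shows "integrable M (\<lambda>\<omega>. f (X \<omega>))"
proof -
  interpret finite_measure M by fact
  obtain B where "\<And>x. norm (f x) \<le> B" "f \<in> borel_measurable borel"
    using trig_poly_bounded_measurable[OF assms(3)] by blast
  then show ?thesis
    using assms(2) by (intro integrable_const_bound[of _ B]) auto
qed

text \<open>Folding the real line by the sine turns a bounded continuous function on a ball
  into a continuous function on a cube; a polynomial approximation there is globally bounded.\<close>

lemma trig_poly_approx:
  fixes f :: "'k::euclidean_space \<Rightarrow> real"
  assumes cont: "continuous_on UNIV f" and C: "\<And>x. \<bar>f x\<bar> \<le> C" and e: "e > 0" and R: "R > 0"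
  obtains h where "trig_poly (\<lambda>x. complex_of_real (h x))" "\<And>x. \<bar>h x\<bar> \<le> C + e"
    "\<And>x. norm x \<le> R \<Longrightarrow> \<bar>f x - h x\<bar> \<le> e"
proof -
  define \<theta> :: "'k \<Rightarrow> 'k" where "\<theta> x = (\<Sum>b\<in>Basis. sin ((x \<bullet> b) / R) *\<^sub>R b)" for x
  define F :: "'k \<Rightarrow> real" where "F y = f (\<Sum>b\<in>Basis. (R * arcsin (y \<bullet> b)) *\<^sub>R b)" for y
  have [simp]: "\<theta> x \<bullet> b = sin ((x \<bullet> b) / R)" if "b \<in> Basis" for x b
    using that by (simp add: \<theta>_def)
  have \<theta>_in: "\<theta> x \<in> cbox (-One) One" for x
    by (simp add: mem_box)
  have "continuous_on (cbox (-One) One) F"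
    unfolding F_def
    by (intro continuous_on_compose2[OF cont] continuous_intros) (auto simp: mem_box)
  then obtain p where p: "real_polynomial_function p"
      "\<And>y. y \<in> cbox (-One) One \<Longrightarrow> \<bar>F y - p y\<bar> < e"
    using Stone_Weierstrass_real_polynomial_function[OF compact_cbox _ e] by metis
  have F\<theta>: "F (\<theta> x) = f x" if "norm x \<le> R" for x
  proof -
    have "R * arcsin (\<theta> x \<bullet> b) = x \<bullet> b" if b: "b \<in> Basis" for b
    proof -
      have "\<bar>x \<bullet> b\<bar> \<le> R"
        using Basis_le_norm[OF b, of x] \<open>norm x \<le> R\<close> by linarith
      then have "- 1 \<le> (x \<bullet> b) / R" "(x \<bullet> b) / R \<le> 1" using R by (auto simp: field_simps)
      then have "arcsin (sin ((x \<bullet> b) / R)) = (x \<bullet> b) / R"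
        using pi_gt3 by (intro arcsin_sin) linarith+
      then show ?thesis using R b by simp
    qed
    then have "F (\<theta> x) = f (\<Sum>b\<in>Basis. (x \<bullet> b) *\<^sub>R b)"
      unfolding F_def by (metis (mono_tags, lifting) sum.cong)
    then show ?thesis by (simp add: euclidean_representation)
  qed
  show thesis
  proof (rule that[of "\<lambda>x. p (\<theta> x)"])
    show "trig_poly (\<lambda>x. complex_of_real (p (\<theta> x)))"
      unfolding \<theta>_def by (rule trig_poly_polynomial_sin[OF p(1)])
    show "\<bar>p (\<theta> x)\<bar> \<le> C + e" for x
      using p(2)[OF \<theta>_in, of x] C[of "\<Sum>b\<in>Basis. (R * arcsin (\<theta> x \<bullet> b)) *\<^sub>R b"]
      unfolding F_def by linarith
    show "\<bar>f x - p (\<theta> x)\<bar> \<le> e" if "norm x \<le> R" for x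
      using p(2)[OF \<theta>_in, of x] F\<theta>[OF that] by simp
  qed
qed

lemma trig_poly_integral_tendsto:
  assumes "finite_measure M" "finite_measure N" "\<And>n. X n \<in> borel_measurable M" "sets N = sets borel"
    and "\<And>t. (\<lambda>n. \<integral>\<omega>. cis (t \<bullet> X n \<omega>) \<partial>M) \<longlonglongrightarrow> (\<integral>x. cis (t \<bullet> x) \<partial>N)"
    and "trig_poly f"
  shows "(\<lambda>n. \<integral>\<omega>. f (X n \<omega>) \<partial>M) \<longlonglongrightarrow> (\<integral>x. f x \<partial>N)"
proof -
  have id: "(\<lambda>x. x) \<in> borel_measurable N"
    using assms(4) by (simp add: measurable_ident_sets)
  note int = trig_poly_integrable[OF assms(1,3)] trig_poly_integrable[OF assms(2) id]
  show ?thesis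
    using assms(6)
  proof (induction rule: trig_poly.induct)
    case (cis t)
    then show ?case by (rule assms(5))
  next
    case (scale f c)
    then show ?case by (auto intro!: tendsto_intros)
  next
    case (add f g)
    then show ?case using int by (auto intro!: tendsto_intros)
  qed
qed

lemma integral_diff_le_tail:
  fixes f h :: "'k::euclidean_space \<Rightarrow> real"
  assumes "prob_space M" and [measurable]: "X \<in> borel_measurable M"
      "f \<in> borel_measurable borel" "h \<in> borel_measurable borel"
    and f: "\<And>x. \<bar>f x\<bar> \<le> A" and h: "\<And>x. \<bar>h x\<bar> \<le> B"
    and fh: "\<And>x. norm x \<le> R \<Longrightarrow> \<bar>f x - h x\<bar> \<le> e" and "0 \<le> e"
  shows "\<bar>(\<integral>\<omega>. f (X \<omega>) \<partial>M) - (\<integral>\<omega>. h (X \<omega>) \<partial>M)\<bar>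
    \<le> e + (A + B) * measure M {\<omega> \<in> space M. norm (X \<omega>) > R}"
proof -
  interpret prob_space M by fact
  let ?T = "{\<omega> \<in> space M. norm (X \<omega>) > R}"
  have int: "integrable M (\<lambda>\<omega>. f (X \<omega>))" "integrable M (\<lambda>\<omega>. h (X \<omega>))"
    using f by (intro integrable_const_bound[of _ A]) (use h in \<open>auto intro!: integrable_const_bound[of _ B]\<close>)
  have AB: "0 \<le> A + B" using f[of 0] h[of 0] by linarith
  have iT: "integrable M (\<lambda>\<omega>. e + (A + B) * indicator ?T \<omega>)"
    by (intro Bochner_Integration.integrable_add integrable_mult_right integrable_real_indicator)
      (auto simp: emeasure_eq_measure)
  have "\<bar>(\<integral>\<omega>. f (X \<omega>) \<partial>M) - (\<integral>\<omega>. h (X \<omega>) \<partial>M)\<bar> = \<bar>\<integral>\<omega>. f (X \<omega>) - h (X \<omega>) \<partial>M\<bar>"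
    using int by simp
  also have "\<dots> \<le> (\<integral>\<omega>. \<bar>f (X \<omega>) - h (X \<omega>)\<bar> \<partial>M)"
    by (rule integral_abs_bound)
  also have "\<dots> \<le> (\<integral>\<omega>. e + (A + B) * indicator ?T \<omega> \<partial>M)"
  proof (rule integral_mono)
    show "integrable M (\<lambda>\<omega>. \<bar>f (X \<omega>) - h (X \<omega>)\<bar>)" using int by auto
    show "\<bar>f (X \<omega>) - h (X \<omega>)\<bar> \<le> e + (A + B) * indicator ?T \<omega>" if "\<omega> \<in> space M" for \<omega>
    proof (cases "norm (X \<omega>) \<le> R")
      case True
      then show ?thesis using fh[of "X \<omega>"] by simp
    next
      case False
      then show ?thesis using f[of "X \<omega>"] h[of "X \<omega>"] that \<open>0 \<le> e\<close> by simp
    qed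
  qed (rule iT)
  also have "\<dots> = e + (A + B) * measure M ?T"
    by (subst Bochner_Integration.integral_add)
      (auto simp: emeasure_eq_measure prob_space)
  finally show ?thesis .
qed

lemma prob_space_tail_small:
  fixes N :: "'k::euclidean_space measure"
  assumes "prob_space N" "sets N = sets borel" "e > 0"
  shows "\<exists>R. measure N {x \<in> space N. norm x > R} < e"
proof -
  interpret prob_space N by fact
  let ?A = "\<lambda>n::nat. {x \<in> space N. norm x > real n}"
  have [measurable]: "(\<lambda>x. x) \<in> borel_measurable N"
    using assms(2) by (simp add: measurable_ident_sets)
  have "(\<lambda>n. measure N (?A n)) \<longlonglongrightarrow> measure N (\<Inter>n. ?A n)"
    by (rule finite_Lim_measure_decseq) (auto simp: decseq_def)
  also have "(\<Inter>n. ?A n) = {}"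
  proof -
    have "\<exists>n::nat. norm x \<le> real n" for x :: 'k by (rule real_arch_simple)
    then show ?thesis by (auto simp: not_less[symmetric])
  qed
  finally have "(\<lambda>n. measure N (?A n)) \<longlonglongrightarrow> 0" by simp
  then have "eventually (\<lambda>n. measure N (?A n) < e) sequentially"
    by (rule order_tendstoD) fact
  then show ?thesis by (auto simp: eventually_sequentially)
qed

theorem conv_in_distr_of_char:
  fixes X :: "nat \<Rightarrow> 's \<Rightarrow> 'k::euclidean_space"
  assumes M: "prob_space M" and X: "\<And>n. X n \<in> borel_measurable M"
    and N: "prob_space N" "sets N = sets borel"
    and char: "\<And>t. (\<lambda>n. \<integral>\<omega>. cis (t \<bullet> X n \<omega>) \<partial>M) \<longlonglongrightarrow> (\<integral>x. cis (t \<bullet> x) \<partial>N)"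
    and tight: "\<And>e. e > 0 \<Longrightarrow> \<exists>R. \<forall>n. measure M {\<omega> \<in> space M. norm (X n \<omega>) > R} < e"
  shows "conv_in_distr M X N"
  unfolding conv_in_distr_def
proof (intro allI impI, elim conjE)
  fix f :: "'k \<Rightarrow> real"
  assume cont: "continuous_on UNIV f" and "bounded (range f)"
  then obtain C where C: "\<And>x. \<bar>f x\<bar> \<le> C" by (auto simp: bounded_iff)
  have C0: "C \<ge> 0" using C[of 0] by linarith
  interpret M: prob_space M by fact
  interpret N: prob_space N by fact
  have id[measurable]: "(\<lambda>x. x) \<in> borel_measurable N"
    using N by (simp add: measurable_ident_sets)
  have f[measurable]: "f \<in> borel_measurable borel"
    using cont by (rule borel_measurable_continuous_onI)
  show "(\<lambda>n. \<integral>\<omega>. f (X n \<omega>) \<partial>M) \<longlonglongrightarrow> (\<integral>x. f x \<partial>N)"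
  proof (rule LIMSEQ_I)
    fix r :: real assume "r > 0"
    define e where "e = min 1 (r / 5)"
    have e: "e > 0" "e \<le> 1" "5 * e \<le> r" using \<open>r > 0\<close> by (auto simp: e_def)
    define \<delta> where "\<delta> = e / (2 * C + 1)"
    have \<delta>: "\<delta> > 0" using e C0 by (simp add: \<delta>_def)
    obtain R1 where R1: "\<And>n. measure M {\<omega> \<in> space M. norm (X n \<omega>) > R1} < \<delta>"
      using tight[OF \<delta>] by blast
    obtain R2 where R2: "measure N {x \<in> space N. norm x > R2} < \<delta>"
      using prob_space_tail_small[OF N \<delta>] by blast
    define R where "R = max 1 (max R1 R2)"
    have RM: "measure M {\<omega> \<in> space M. norm (X n \<omega>) > R} \<le> \<delta>" for n
    proof -
      note X[measurable]
      have "measure M {\<omega> \<in> space M. norm (X n \<omega>) > R} \<le> measure M {\<omega> \<in> space M. norm (X n \<omega>) > R1}"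
        by (rule M.finite_measure_mono) (auto simp: R_def)
      then show ?thesis using R1[of n] by simp
    qed
    have RN: "measure N {x \<in> space N. norm x > R} \<le> \<delta>"
    proof -
      have "measure N {x \<in> space N. norm x > R} \<le> measure N {x \<in> space N. norm x > R2}"
        by (rule N.finite_measure_mono) (auto simp: R_def)
      then show ?thesis using R2 by simp
    qed
    have "R > 0" by (simp add: R_def)
    from trig_poly_approx[OF cont C e(1) this]
    obtain h where h: "trig_poly (\<lambda>x. complex_of_real (h x))" "\<And>x. \<bar>h x\<bar> \<le> C + e"
      "\<And>x. norm x \<le> R \<Longrightarrow> \<bar>f x - h x\<bar> \<le> e" by blast
    have "(\<lambda>x. complex_of_real (h x)) \<in> borel_measurable borel"
      using trig_poly_bounded_measurable[OF h(1)] by blast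
    then have "(\<lambda>x. Re (complex_of_real (h x))) \<in> borel_measurable borel" by measurable
    then have hm: "h \<in> borel_measurable borel" by (simp only: Re_complex_of_real)
    have "(\<lambda>n. Re (\<integral>\<omega>. complex_of_real (h (X n \<omega>)) \<partial>M)) \<longlonglongrightarrow> Re (\<integral>x. complex_of_real (h x) \<partial>N)"
      by (rule tendsto_Re[OF trig_poly_integral_tendsto[OF M.finite_measure_axioms
            N.finite_measure_axioms X N(2) char h(1)]])
    then have "(\<lambda>n. \<integral>\<omega>. h (X n \<omega>) \<partial>M) \<longlonglongrightarrow> (\<integral>x. h x \<partial>N)" by simp
    from LIMSEQ_D[OF this e(1)] obtain n0 where n0:
      "\<And>n. n \<ge> n0 \<Longrightarrow> \<bar>(\<integral>\<omega>. h (X n \<omega>) \<partial>M) - (\<integral>x. h x \<partial>N)\<bar> < e" by auto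
    have "(C + (C + e)) * x \<le> e" if "x \<le> \<delta>" for x
    proof -
      have "(C + (C + e)) * x \<le> (C + (C + e)) * \<delta>"
        using that C0 e by (intro mult_left_mono) auto
      also have "\<dots> \<le> (2 * C + 1) * \<delta>" using e \<delta> by (intro mult_right_mono) auto
      finally show ?thesis using C0 by (simp add: \<delta>_def)
    qed
    note small = this[OF RM] this[OF RN]
    have dM: "\<bar>(\<integral>\<omega>. f (X n \<omega>) \<partial>M) - (\<integral>\<omega>. h (X n \<omega>) \<partial>M)\<bar> \<le> 2 * e" for n
      using integral_diff_le_tail[where R = R, OF M X[of n] f hm C h(2) h(3) less_imp_le[OF e(1)]] small(1)[of n]
      by linarith
    have dN: "\<bar>(\<integral>x. f x \<partial>N) - (\<integral>x. h x \<partial>N)\<bar> \<le> 2 * e"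
      using integral_diff_le_tail[where R = R, OF N(1) id f hm C h(2) h(3) less_imp_le[OF e(1)]] small(2)
      by linarith
    show "\<exists>n0. \<forall>n\<ge>n0. norm ((\<integral>\<omega>. f (X n \<omega>) \<partial>M) - (\<integral>x. f x \<partial>N)) < r"
    proof (intro exI[of _ n0] allI impI)
      fix n assume "n0 \<le> n"
      show "norm ((\<integral>\<omega>. f (X n \<omega>) \<partial>M) - (\<integral>x. f x \<partial>N)) < r"
        using n0[OF \<open>n0 \<le> n\<close>] dM[of n] dN e unfolding real_norm_def by linarith
    qed
  qed
qed

section \<open>The multivariate central limit theorem\<close>

text \<open>Lagrange's reduction of a quadratic form, by induction on the set of basis vectors on which
  the form does not vanish.\<close>

lemma psd_form_sum_squares_aux:
  fixes B :: "'k::euclidean_space \<Rightarrow> 'k \<Rightarrow> real"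
  assumes "finite A" "A \<subseteq> Basis" "\<And>y. linear (\<lambda>x. B x y)" "\<And>x y. B x y = B y x" "\<And>x. B x x \<ge> 0"
    and "\<And>b x. b \<in> Basis - A \<Longrightarrow> B b x = 0"
  shows "\<exists>a. \<forall>x. B x x = (\<Sum>b\<in>A. (x \<bullet> a b)\<^sup>2)"
  using assms
proof (induction A arbitrary: B rule: finite_induct)
  case empty
  have "B x x = 0" for x
  proof -
    interpret linear "\<lambda>y. B y x" by (rule empty)
    have "B x x = B (\<Sum>b\<in>Basis. (x \<bullet> b) *\<^sub>R b) x" by (simp add: euclidean_representation)
    also have "\<dots> = 0" using empty(5) by (simp only: sum scale) simp
    finally show ?thesis .
  qed
  then show ?case by simp
next
  case (insert c A)
  note lin = insert.prems(2) and sym = insert.prems(3) and pos = insert.prems(4)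
  have addl: "B (x + y) z = B x z + B y z" and scl: "B (r *\<^sub>R x) z = r * B x z" for x y z r
    using lin[of z] by (simp_all add: linear_iff)
  have addr: "B z (x + y) = B z x + B z y" and scr: "B z (r *\<^sub>R x) = r * B z x" for x y z r
    by (simp_all add: sym[of z] addl scl)
  note bil = addl addr scl scr
  define \<beta> where "\<beta> = B c c"
  have quad: "0 \<le> B x x + 2 * r * B x c + r\<^sup>2 * \<beta>" for x r
    using pos[of "x + r *\<^sub>R c"] by (simp add: bil sym[of c x] \<beta>_def algebra_simps power2_eq_square)
  have CS: "(B x c)\<^sup>2 \<le> B x x * \<beta>" for x
  proof (cases "\<beta> = 0")
    case True
    have "B x c = 0"
    proof (rule ccontr)
      assume "B x c \<noteq> 0"
      define r where "r = - (B x x + 1) / (2 * B x c)"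
      have "2 * r * B x c = - (B x x + 1)" using \<open>B x c \<noteq> 0\<close> by (simp add: r_def)
      then show False using quad[of x r] True by simp
    qed
    then show ?thesis using True by simp
  next
    case False
    then have "\<beta> > 0" using pos[of c] by (simp add: \<beta>_def)
    then show ?thesis
      using quad[of x "- B x c / \<beta>"] by (simp add: field_simps power2_eq_square)
  qed
  have zero: "B x c = 0" if "\<beta> = 0" for x
    using CS[of x] that by simp
  define B' where "B' x y = B x y - B x c * B y c / \<beta>" for x y
  have ex: "\<exists>a. \<forall>x. B' x x = (\<Sum>b\<in>A. (x \<bullet> a b)\<^sup>2)"
  proof (rule insert.IH[of B'])
    show "A \<subseteq> Basis" using insert.prems by simp
    show "linear (\<lambda>x. B' x y)" for y
      by (rule linearI) (simp_all add: B'_def bil algebra_simps add_divide_distrib diff_divide_distrib)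
    show "B' x y = B' y x" for x y by (simp add: B'_def sym[of x y])
    show "0 \<le> B' x x" for x
    proof (cases "\<beta> = 0")
      case True
      then show ?thesis by (simp add: B'_def pos)
    next
      case False
      then have "\<beta> > 0" using pos[of c] by (simp add: \<beta>_def)
      then show ?thesis using CS[of x] by (simp add: B'_def field_simps power2_eq_square)
    qed
    show "B' b x = 0" if "b \<in> Basis - A" for b x
    proof (cases "b = c")
      case True
      then show ?thesis
        using zero by (cases "\<beta> = 0") (auto simp: B'_def sym[of c x] \<beta>_def)
    next
      case False
      then show ?thesis using insert.prems(5)[of b] that by (simp add: B'_def)
    qed
  qed
  then obtain a where a: "\<And>x. B' x x = (\<Sum>b\<in>A. (x \<bullet> a b)\<^sup>2)" by blast
  define l where "l = adjoint (\<lambda>x. B x c) 1"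
  have l: "B x c = x \<bullet> l" for x
    using adjoint_works[OF lin[of c], of x 1] by (simp add: l_def)
  have \<beta>0: "\<beta> \<ge> 0" using pos[of c] by (simp add: \<beta>_def)
  let ?a = "a(c := (1 / sqrt \<beta>) *\<^sub>R l)"
  have "B x x = (\<Sum>b\<in>insert c A. (x \<bullet> ?a b)\<^sup>2)" for x
  proof -
    have "(\<Sum>b\<in>A. (x \<bullet> ?a b)\<^sup>2) = B' x x"
      unfolding a using insert.hyps by (intro sum.cong) auto
    then have "(\<Sum>b\<in>insert c A. (x \<bullet> ?a b)\<^sup>2) = (B x c)\<^sup>2 / \<beta> + B' x x"
      using insert.hyps \<beta>0 by (simp add: l power_divide)
    also have "\<dots> = B x x" by (simp add: B'_def power2_eq_square)
    finally show ?thesis ..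
  qed
  then show ?case by blast
qed

lemma psd_form_sum_squares:
  fixes B :: "'k::euclidean_space \<Rightarrow> 'k \<Rightarrow> real"
  assumes "\<And>y. linear (\<lambda>x. B x y)" "\<And>x y. B x y = B y x" "\<And>x. B x x \<ge> 0"
  shows "\<exists>a :: 'k \<Rightarrow> 'k. \<forall>x. B x x = (\<Sum>b\<in>Basis. (x \<bullet> a b)\<^sup>2)"
  by (rule psd_form_sum_squares_aux[of Basis B, OF _ _ assms]) auto

lemma integral_cis_std_normal:
  "(\<integral>x. cis (s * x) \<partial>std_normal_distribution) = complex_of_real (exp (- s\<^sup>2 / 2))"
  using fun_cong[OF char_std_normal_distribution, of s] by (simp add: char_def cis_conv_exp)

lemma is_normal_0_exists:
  fixes a :: "'k \<Rightarrow> 'k::euclidean_space"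
  assumes "\<And>x. x \<bullet> S x = (\<Sum>b\<in>Basis. (x \<bullet> a b)\<^sup>2)"
  shows "\<exists>N. is_normal_0 N S"
proof -
  interpret std: prob_space std_normal_distribution
    by (rule prob_space_normal_density) simp
  interpret product_prob_space "\<lambda>_::'k. std_normal_distribution" Basis ..
  let ?P = "Pi\<^sub>M (Basis :: 'k set) (\<lambda>_. std_normal_distribution)"
  define G where "G z = (\<Sum>b\<in>Basis. z b *\<^sub>R a b)" for z :: "'k \<Rightarrow> real"
  have [measurable]: "G \<in> borel_measurable ?P"
    unfolding G_def by (intro borel_measurable_sum borel_measurable_scaleR measurable_const)
      (auto intro: measurable_component_singleton[THEN measurable_compose])
  show ?thesis
  proof (intro exI[of _ "distr ?P borel G"], unfold is_normal_0_def, intro conjI allI)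
    show "prob_space (distr ?P borel G)"
      by (rule prob_space_distr) simp
    show "sets (distr ?P borel G) = sets borel" by simp
    fix t :: 'k
    have cis_sum: "cis (\<Sum>b\<in>A. f b) = (\<Prod>b\<in>A. cis (f b))" if "finite A" for A and f :: "'k \<Rightarrow> real"
      using that by (induction A rule: finite_induct) (auto simp: cis_mult[symmetric])
    have cis_m: "(\<lambda>x. cis (f x)) \<in> borel_measurable M" if "f \<in> borel_measurable M" for f and M :: "'z measure"
      using that by (intro measurable_compose[OF that borel_measurable_continuous_onI]) (intro continuous_intros)
    have "(\<integral>x. cis (t \<bullet> x) \<partial>distr ?P borel G) = (\<integral>z. cis (t \<bullet> G z) \<partial>?P)"
      by (rule integral_distr) (auto intro!: cis_m)
    also have "\<dots> = (\<integral>z. (\<Prod>b\<in>Basis. cis ((t \<bullet> a b) * z b)) \<partial>?P)"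
      by (simp add: G_def inner_sum_right cis_sum mult.commute)
    also have "\<dots> = (\<Prod>b\<in>Basis. \<integral>x. cis ((t \<bullet> a b) * x) \<partial>std_normal_distribution)"
      by (rule product_integral_prod)
        (auto intro!: std.integrable_const_bound[of _ 1] cis_m)
    also have "\<dots> = complex_of_real (exp (- (\<Sum>b\<in>Basis. (t \<bullet> a b)\<^sup>2) / 2))"
      by (simp add: integral_cis_std_normal sum_negf[symmetric] sum_divide_distrib exp_sum flip: of_real_prod)
    finally show "(\<integral>x. cis (t \<bullet> x) \<partial>distr ?P borel G) = complex_of_real (exp (- (t \<bullet> S t) / 2))"
      by (simp add: assms)
  qed
qed

lemma (in prob_space) indep_sum_second_moment:
  fixes X :: "nat \<Rightarrow> 'a \<Rightarrow> real"
  assumes "indep_vars (\<lambda>_. borel) X UNIV" and int: "\<And>j. integrable M (\<lambda>\<omega>. (X j \<omega>)\<^sup>2)"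
    and mean: "\<And>j. expectation (X j) = 0" and var: "\<And>j. expectation (\<lambda>\<omega>. (X j \<omega>)\<^sup>2) = v"
  shows "integrable M (\<lambda>\<omega>. (\<Sum>j<n. X j \<omega>)\<^sup>2) \<and> expectation (\<lambda>\<omega>. (\<Sum>j<n. X j \<omega>)\<^sup>2) = real n * v"
proof (induction n)
  case 0
  then show ?case by simp
next
  case (Suc n)
  have X[measurable]: "X j \<in> borel_measurable M" for j
    using assms(1) by (auto simp: indep_vars_def)
  have iX: "integrable M (X j)" for j
    by (rule square_integrable_imp_integrable) (auto intro: int)
  have ind: "indep_var borel (X n) borel (\<lambda>\<omega>. \<Sum>j<n. X j \<omega>)"
    by (rule indep_vars_sum) (auto intro: indep_vars_subset[OF assms(1)])
  have iS: "integrable M (\<lambda>\<omega>. \<Sum>j<n. X j \<omega>)" using iX by simp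
  note prod = indep_var_lebesgue_integral[OF ind iX iS] indep_var_integrable[OF ind iX iS]
  have eq: "(\<lambda>\<omega>. (\<Sum>j<Suc n. X j \<omega>)\<^sup>2)
      = (\<lambda>\<omega>. (\<Sum>j<n. X j \<omega>)\<^sup>2 + 2 * (X n \<omega> * (\<Sum>j<n. X j \<omega>)) + (X n \<omega>)\<^sup>2)"
    by (simp add: power2_sum algebra_simps)
  show ?case
    unfolding eq using Suc int prod mean var iS by (auto simp: algebra_simps)
qed

text \<open>The covariance is described by its quadratic form \<open>t \<bullet> S t\<close> only, since that is all
  the characteristic function sees.\<close>

locale iid_centred = prob_space M for M :: "'s measure" +
  fixes W :: "nat \<Rightarrow> 's \<Rightarrow> 'k::euclidean_space" and S :: "'k \<Rightarrow> 'k"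
  assumes indep: "indep_vars (\<lambda>_. borel) W UNIV"
    and ident: "\<And>j. distr M borel (W j) = distr M borel (W 0)"
    and square_int: "integrable M (\<lambda>\<omega>. (norm (W 0 \<omega>))\<^sup>2)"
    and mean: "\<And>t. expectation (\<lambda>\<omega>. t \<bullet> W 0 \<omega>) = 0"
    and cov: "\<And>t. expectation (\<lambda>\<omega>. (t \<bullet> W 0 \<omega>)\<^sup>2) = t \<bullet> S t"
begin

lemma W_measurable[measurable]: "W j \<in> borel_measurable M"
  using indep by (auto simp: indep_vars_def)

lemma
  fixes f :: "'k \<Rightarrow> 'b::{banach, second_countable_topology}"
  assumes "f \<in> borel_measurable borel"
  shows expectation_W: "expectation (\<lambda>\<omega>. f (W j \<omega>)) = expectation (\<lambda>\<omega>. f (W 0 \<omega>))"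
    and integrable_W: "integrable M (\<lambda>\<omega>. f (W j \<omega>)) = integrable M (\<lambda>\<omega>. f (W 0 \<omega>))"
  using integral_distr[of "W j" M borel f] integral_distr[of "W 0" M borel f]
    integrable_distr_eq[of "W j" M borel f] integrable_distr_eq[of "W 0" M borel f] assms ident[of j]
  by auto

lemma inner_square_integrable0: "integrable M (\<lambda>\<omega>. (t \<bullet> W 0 \<omega>)\<^sup>2)"
proof (rule Bochner_Integration.integrable_bound)
  show "integrable M (\<lambda>\<omega>. (norm t)\<^sup>2 * (norm (W 0 \<omega>))\<^sup>2)" using square_int by simp
  have "(t \<bullet> x)\<^sup>2 \<le> (norm t)\<^sup>2 * (norm x)\<^sup>2" for x :: 'k
    using Cauchy_Schwarz_ineq[of t x] by (simp add: power2_norm_eq_inner)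
  then show "AE \<omega> in M. norm ((t \<bullet> W 0 \<omega>)\<^sup>2) \<le> norm ((norm t)\<^sup>2 * (norm (W 0 \<omega>))\<^sup>2)" by simp
qed measurable

lemma inner_square_integrable: "integrable M (\<lambda>\<omega>. (t \<bullet> W j \<omega>)\<^sup>2)"
  using integrable_W[of "\<lambda>x. (t \<bullet> x)\<^sup>2" j] inner_square_integrable0 by simp

lemma inner_mean: "expectation (\<lambda>\<omega>. t \<bullet> W j \<omega>) = 0"
  using expectation_W[of "\<lambda>x. t \<bullet> x" j] mean by simp

lemma inner_cov: "expectation (\<lambda>\<omega>. (t \<bullet> W j \<omega>)\<^sup>2) = t \<bullet> S t"
  using expectation_W[of "\<lambda>x. (t \<bullet> x)\<^sup>2" j] cov by simp

lemma inner_indep: "indep_vars (\<lambda>_. borel) (\<lambda>j \<omega>. t \<bullet> W j \<omega>) UNIV"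
  by (rule indep_vars_compose2[OF indep]) simp

lemma sum_norm_square:
  "integrable M (\<lambda>\<omega>. (norm (\<Sum>j<n. W j \<omega>))\<^sup>2)"
  "expectation (\<lambda>\<omega>. (norm (\<Sum>j<n. W j \<omega>))\<^sup>2) = real n * (\<Sum>b\<in>Basis. b \<bullet> S b)"
proof -
  have eq: "(norm (\<Sum>j<n. W j \<omega>))\<^sup>2 = (\<Sum>b\<in>Basis. (\<Sum>j<n. b \<bullet> W j \<omega>)\<^sup>2)" for \<omega>
    unfolding power2_norm_eq_inner
    by (subst euclidean_inner) (simp add: inner_sum_left inner_commute[of _ "W _ _"] power2_eq_square)
  note m = indep_sum_second_moment[OF inner_indep inner_square_integrable inner_mean inner_cov]
  show "integrable M (\<lambda>\<omega>. (norm (\<Sum>j<n. W j \<omega>))\<^sup>2)"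
    unfolding eq using m by auto
  show "expectation (\<lambda>\<omega>. (norm (\<Sum>j<n. W j \<omega>))\<^sup>2) = real n * (\<Sum>b\<in>Basis. b \<bullet> S b)"
    unfolding eq using m by (simp add: sum_distrib_left)
qed

lemma sum_tail:
  assumes "r > 0"
  shows "prob {\<omega> \<in> space M. norm (\<Sum>j<n. W j \<omega>) \<ge> r} \<le> real n * (\<Sum>b\<in>Basis. b \<bullet> S b) / r\<^sup>2"
proof -
  have "prob {\<omega> \<in> space M. \<bar>norm (\<Sum>j<n. W j \<omega>)\<bar> \<ge> r}
      \<le> expectation (\<lambda>\<omega>. (norm (\<Sum>j<n. W j \<omega>))\<^sup>2) / r\<^sup>2"
    by (rule second_moment_method) (use assms sum_norm_square in auto)
  then show ?thesis by (simp add: sum_norm_square)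
qed

lemma weak_law:
  assumes "\<epsilon> > 0"
  shows "(\<lambda>n. prob {\<omega> \<in> space M. norm ((1 / real n) *\<^sub>R (\<Sum>j<n. W j \<omega>)) > \<epsilon>}) \<longlonglongrightarrow> 0"
proof (rule tendsto_sandwich[of "\<lambda>_. 0"])
  let ?C = "\<Sum>b\<in>Basis. b \<bullet> S b"
  show "(\<lambda>n. ?C / \<epsilon>\<^sup>2 / real n) \<longlonglongrightarrow> 0"
    by (rule lim_const_over_n)
  show "\<forall>\<^sub>F n in sequentially. prob {\<omega> \<in> space M. norm ((1 / real n) *\<^sub>R (\<Sum>j<n. W j \<omega>)) > \<epsilon>}
      \<le> ?C / \<epsilon>\<^sup>2 / real n"
  proof (rule eventually_sequentiallyI[of 1])
    fix n :: nat assume n: "1 \<le> n"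
    have "prob {\<omega> \<in> space M. norm ((1 / real n) *\<^sub>R (\<Sum>j<n. W j \<omega>)) > \<epsilon>}
        \<le> prob {\<omega> \<in> space M. norm (\<Sum>j<n. W j \<omega>) \<ge> \<epsilon> * real n}"
      using n by (intro finite_measure_mono) (auto simp: field_simps)
    also have "\<dots> \<le> real n * ?C / (\<epsilon> * real n)\<^sup>2"
      using n assms by (intro sum_tail) simp
    also have "\<dots> = ?C / \<epsilon>\<^sup>2 / real n"
      using n by (simp add: power2_eq_square field_simps)
    finally show "prob {\<omega> \<in> space M. norm ((1 / real n) *\<^sub>R (\<Sum>j<n. W j \<omega>)) > \<epsilon>} \<le> ?C / \<epsilon>\<^sup>2 / real n" .
  qed
qed (auto intro!: always_eventually)

lemma char_normalized_sum_tendsto: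
  "(\<lambda>n. \<integral>\<omega>. cis (t \<bullet> ((1 / sqrt (real n)) *\<^sub>R (\<Sum>j<n. W j \<omega>))) \<partial>M)
    \<longlonglongrightarrow> complex_of_real (exp (- (t \<bullet> S t) / 2))"
proof (cases "t \<bullet> S t = 0")
  case True
  have "AE \<omega> in M. t \<bullet> W j \<omega> = 0" for j
  proof -
    have "AE \<omega> in M. (t \<bullet> W j \<omega>)\<^sup>2 = 0"
      using integral_nonneg_eq_0_iff_AE[OF inner_square_integrable[of t j]] inner_cov[of t j] True by simp
    then show ?thesis by simp
  qed
  then have AE: "AE \<omega> in M. \<forall>j. t \<bullet> W j \<omega> = 0" by (simp add: AE_all_countable)
  have "(\<integral>\<omega>. cis (t \<bullet> ((1 / sqrt (real n)) *\<^sub>R (\<Sum>j<n. W j \<omega>))) \<partial>M) = 1" for n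
  proof -
    have "(\<integral>\<omega>. cis (t \<bullet> ((1 / sqrt (real n)) *\<^sub>R (\<Sum>j<n. W j \<omega>))) \<partial>M) = (\<integral>\<omega>. 1 \<partial>M)"
      using trig_poly_bounded_measurable[OF trig_poly.cis[of t]]
      by (intro integral_cong_AE eventually_mono[OF AE]
          measurable_compose[of _ M borel "\<lambda>x. cis (t \<bullet> x)"]) (auto simp: inner_sum_right)
    then show ?thesis by (simp add: prob_space)
  qed
  then show ?thesis using True by simp
next
  case False
  have "t \<bullet> S t \<ge> 0" by (simp add: cov[symmetric])
  with False have pos: "t \<bullet> S t > 0" by simp
  define \<sigma> where "\<sigma> = sqrt (t \<bullet> S t)"
  have \<sigma>: "\<sigma> > 0" "\<sigma>\<^sup>2 = t \<bullet> S t" using pos by (auto simp: \<sigma>_def)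
  let ?X = "\<lambda>j \<omega>. t \<bullet> W j \<omega>"
  have clt: "weak_conv_m (\<lambda>n. distr M borel (\<lambda>\<omega>. (\<Sum>j<n. ?X j \<omega>) / sqrt (n * \<sigma>\<^sup>2))) std_normal_distribution"
  proof (rule central_limit_theorem_zero_mean[of ?X \<sigma> "distr M borel (?X 0)"])
    show "distr M borel (?X n) = distr M borel (?X 0)" for n
      using ident[of n] distr_distr[of "\<lambda>x. t \<bullet> x" borel borel "W n" M]
        distr_distr[of "\<lambda>x. t \<bullet> x" borel borel "W 0" M] by (simp add: comp_def)
  qed (use inner_indep inner_mean inner_square_integrable inner_cov \<sigma> in auto)
  have "(\<lambda>n. char (distr M borel (\<lambda>\<omega>. (\<Sum>j<n. ?X j \<omega>) / sqrt (n * \<sigma>\<^sup>2))) \<sigma>)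
      \<longlonglongrightarrow> char std_normal_distribution \<sigma>"
    using clt by (rule levy_continuity1[rotated 2]) (auto intro: real_distribution_distr real_dist_normal_dist)
  moreover have "char (distr M borel (\<lambda>\<omega>. (\<Sum>j<n. ?X j \<omega>) / sqrt (n * \<sigma>\<^sup>2))) \<sigma>
      = (\<integral>\<omega>. cis (t \<bullet> ((1 / sqrt (real n)) *\<^sub>R (\<Sum>j<n. W j \<omega>))) \<partial>M)" for n
  proof -
    have "\<sigma> * (y / sqrt (real n * \<sigma>\<^sup>2)) = y / sqrt (real n)" for y
      using \<sigma>(1) by (simp add: real_sqrt_mult)
    then show ?thesis
      by (simp add: char_def integral_distr cis_conv_exp inner_sum_right flip: of_real_mult of_real_divide of_real_sum)
  qed
  ultimately show ?thesis
    by (simp add: char_std_normal_distribution \<sigma>)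
qed

lemma normalized_sum_tight:
  assumes "e > 0"
  shows "\<exists>R. \<forall>n. prob {\<omega> \<in> space M. norm ((1 / sqrt (real n)) *\<^sub>R (\<Sum>j<n. W j \<omega>)) > R} < e"
proof -
  define C where "C = (\<Sum>b\<in>Basis. b \<bullet> S b)"
  have C: "C \<ge> 0" unfolding C_def by (intro sum_nonneg) (simp add: cov[symmetric])
  define R where "R = sqrt ((C + 1) / e)"
  have R: "R > 0" "R\<^sup>2 = (C + 1) / e" using C assms by (auto simp: R_def)
  have "prob {\<omega> \<in> space M. norm ((1 / sqrt (real n)) *\<^sub>R (\<Sum>j<n. W j \<omega>)) > R} < e" for n
  proof (cases "n = 0")
    case True
    then show ?thesis using R assms by simp
  next
    case False
    have "prob {\<omega> \<in> space M. norm ((1 / sqrt (real n)) *\<^sub>R (\<Sum>j<n. W j \<omega>)) > R}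
        \<le> prob {\<omega> \<in> space M. norm (\<Sum>j<n. W j \<omega>) \<ge> R * sqrt (real n)}"
      using False by (intro finite_measure_mono) (auto simp: field_simps)
    also have "\<dots> \<le> real n * C / (R * sqrt (real n))\<^sup>2"
      unfolding C_def using R False by (intro sum_tail) simp
    also have "\<dots> = C * e / (C + 1)"
      using False R by (simp add: power_mult_distrib)
    also have "\<dots> < e" using C assms by (simp add: field_simps)
    finally show ?thesis .
  qed
  then show ?thesis by blast
qed

lemma normal_limit_exists: "\<exists>N. is_normal_0 N S"
proof -
  let ?B = "\<lambda>x y. expectation (\<lambda>\<omega>. (x \<bullet> W 0 \<omega>) * (y \<bullet> W 0 \<omega>))"
  have int: "integrable M (\<lambda>\<omega>. (x \<bullet> W 0 \<omega>) * (y \<bullet> W 0 \<omega>))" for x y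
  proof -
    have "(\<lambda>\<omega>. (x \<bullet> W 0 \<omega>) * (y \<bullet> W 0 \<omega>))
        = (\<lambda>\<omega>. (((x + y) \<bullet> W 0 \<omega>)\<^sup>2 - ((x - y) \<bullet> W 0 \<omega>)\<^sup>2) / 4)"
      by (simp add: inner_add_left inner_diff_left power2_eq_square algebra_simps)
    then show ?thesis
      using inner_square_integrable0[of "x + y"] inner_square_integrable0[of "x - y"] by simp
  qed
  have "\<exists>a :: 'k \<Rightarrow> 'k. \<forall>x. ?B x x = (\<Sum>b\<in>Basis. (x \<bullet> a b)\<^sup>2)"
  proof (rule psd_form_sum_squares[of ?B])
    show "linear (\<lambda>x. ?B x y)" for y
      using int by (intro linearI) (simp_all add: inner_add_left distrib_right mult.assoc)
  qed (auto simp: mult.commute)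
  then obtain a :: "'k \<Rightarrow> 'k" where "\<And>x. ?B x x = (\<Sum>b\<in>Basis. (x \<bullet> a b)\<^sup>2)" by blast
  then show ?thesis
    by (intro is_normal_0_exists[of S a]) (simp add: cov[symmetric] power2_eq_square)
qed

theorem central_limit:
  "\<exists>N. is_normal_0 N S
    \<and> conv_in_distr M (\<lambda>n \<omega>. (1 / sqrt (real n)) *\<^sub>R (\<Sum>j<n. W j \<omega>)) N"
proof -
  obtain N where N: "is_normal_0 N S" using normal_limit_exists by blast
  have "conv_in_distr M (\<lambda>n \<omega>. (1 / sqrt (real n)) *\<^sub>R (\<Sum>j<n. W j \<omega>)) N"
    using N char_normalized_sum_tendsto normalized_sum_tight
    by (intro conv_in_distr_of_char) (auto simp: is_normal_0_def prob_space_axioms)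
  then show ?thesis using N by blast
qed

end

section \<open>Rotation-invariant measures on the sphere\<close>

lemma nn_integral_lborel_plus:
  fixes c :: "'a::euclidean_space"
  assumes "h \<in> borel_measurable borel"
  shows "(\<integral>\<^sup>+x. h (c + x) \<partial>lborel) = (\<integral>\<^sup>+x. h x \<partial>lborel)"
proof -
  have "(\<integral>\<^sup>+x. h x \<partial>distr lborel borel ((+) c)) = (\<integral>\<^sup>+x. h (c + x) \<partial>lborel)"
    by (rule nn_integral_distr) (use assms in auto)
  then show ?thesis by (simp add: lborel_distr_plus)
qed

text \<open>The uniqueness argument for Haar measure, tested against the unit ball: the double integral
  of \<open>1\<^bsub>ball\<^esub> x * 1\<^bsub>A\<^esub> (y + T x)\<close> is evaluated in both orders.\<close>

lemma distr_lborel_orthogonal: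
  fixes T :: "'a::euclidean_space \<Rightarrow> 'a"
  assumes T: "orthogonal_transformation T"
  shows "distr lborel borel T = lborel"
proof (rule measure_eqI)
  fix A assume "A \<in> sets (distr lborel borel T)"
  then have A[measurable]: "A \<in> sets borel" by simp
  have lin: "linear T" using T by (rule orthogonal_transformation_linear)
  have [measurable]: "T \<in> borel_measurable borel"
    using lin by (intro borel_measurable_continuous_onI linear_continuous_on) (simp add: linear_conv_bounded_linear)
  let ?T' = "inv T"
  have T': "T (?T' y) = y" for y
    using orthogonal_transformation_surj[OF T] by (rule surj_f_inv_f)
  have [measurable]: "?T' \<in> borel_measurable borel"
    using orthogonal_transformation_linear[OF orthogonal_transformation_inv[OF T]]
    by (intro borel_measurable_continuous_onI linear_continuous_on) (simp add: linear_conv_bounded_linear)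
  define f :: "'a \<Rightarrow> ennreal" where "f = indicator (ball 0 1)"
  define g :: "'a \<Rightarrow> ennreal" where "g = indicator A"
  have [measurable]: "f \<in> borel_measurable borel" "g \<in> borel_measurable borel"
    by (auto simp: f_def g_def intro!: borel_measurable_indicator)
  let ?v = "emeasure lborel (ball 0 1 :: 'a set)"
  have "measure lborel (ball 0 1 :: 'a set) > 0" by simp
  then have v: "?v \<noteq> 0" "?v \<noteq> \<infinity>"
    by (auto simp only: measure_def enn2real_0 infinity_ennreal_def enn2real_top less_irrefl)
  have "?v * emeasure lborel A = (\<integral>\<^sup>+x. f x * emeasure lborel A \<partial>lborel)"
    unfolding f_def by (subst nn_integral_multc) (simp_all add: borel_measurable_indicator)
  also have "\<dots> = (\<integral>\<^sup>+x. f x * (\<integral>\<^sup>+y. g (T x + y) \<partial>lborel) \<partial>lborel)"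
    by (simp add: nn_integral_lborel_plus g_def)
  also have "\<dots> = (\<integral>\<^sup>+x. (\<integral>\<^sup>+y. f x * g (T x + y) \<partial>lborel) \<partial>lborel)"
    by (simp add: nn_integral_cmult)
  also have "\<dots> = (\<integral>\<^sup>+y. (\<integral>\<^sup>+x. f x * g (T x + y) \<partial>lborel) \<partial>lborel)"
    by (rule lborel_pair.Fubini') measurable
  also have "\<dots> = (\<integral>\<^sup>+y. (\<integral>\<^sup>+x. f (- ?T' y + x) * g (T x) \<partial>lborel) \<partial>lborel)"
  proof (rule nn_integral_cong)
    fix y
    have "T (- ?T' y + x) = T x - y" for x
      using lin by (simp add: linear_diff T')
    then show "(\<integral>\<^sup>+x. f x * g (T x + y) \<partial>lborel) = (\<integral>\<^sup>+x. f (- ?T' y + x) * g (T x) \<partial>lborel)"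
      by (subst nn_integral_lborel_plus[of _ "- ?T' y", symmetric]) auto
  qed
  also have "\<dots> = (\<integral>\<^sup>+x. (\<integral>\<^sup>+y. f (- ?T' y + x) * g (T x) \<partial>lborel) \<partial>lborel)"
    by (rule lborel_pair.Fubini') measurable
  also have "\<dots> = (\<integral>\<^sup>+x. ?v * g (T x) \<partial>lborel)"
  proof (rule nn_integral_cong)
    fix x
    have "norm (- ?T' y + x) = dist (T x) y" for y
      using orthogonal_transformation_norm[OF T, of "- ?T' y + x"] lin
      by (simp add: linear_diff T' dist_norm)
    then have "f (- ?T' y + x) = indicator (ball (T x) 1) y" for y
      by (simp add: f_def indicator_def)
    then have "(\<integral>\<^sup>+y. f (- ?T' y + x) * g (T x) \<partial>lborel) = emeasure lborel (ball (T x) 1) * g (T x)"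
      by (simp add: nn_integral_multc borel_measurable_indicator)
    then show "(\<integral>\<^sup>+y. f (- ?T' y + x) * g (T x) \<partial>lborel) = ?v * g (T x)"
      by (simp add: emeasure_ball)
  qed
  also have "\<dots> = ?v * (\<integral>\<^sup>+x. g x \<partial>distr lborel borel T)"
    by (simp add: nn_integral_cmult nn_integral_distr)
  also have "\<dots> = ?v * emeasure (distr lborel borel T) A"
    by (simp add: g_def)
  finally show "emeasure (distr lborel borel T) A = emeasure lborel A"
    using v by (simp add: ennreal_mult_cancel_left)
qed simp

lemma has_real_derivative_integral:
  fixes f f' :: "real \<Rightarrow> 'a \<Rightarrow> real"
  assumes "finite_measure M" and \<delta>: "\<delta> > 0"
    and der: "AE u in M. \<forall>y. \<bar>y - x\<bar> < \<delta> \<longrightarrow>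
        ((\<lambda>y. f y u) has_real_derivative f' y u) (at y) \<and> \<bar>f' y u\<bar> \<le> B"
    and int: "\<And>y. \<bar>y - x\<bar> < \<delta> \<Longrightarrow> integrable M (f y)"
    and meas[measurable]: "f' x \<in> borel_measurable M"
  shows "((\<lambda>y. \<integral>u. f y u \<partial>M) has_real_derivative (\<integral>u. f' x u \<partial>M)) (at x)"
proof -
  interpret finite_measure M by fact
  let ?S = "{x - \<delta><..<x + \<delta>}"
  have S: "y \<in> ?S \<longleftrightarrow> \<bar>y - x\<bar> < \<delta>" for y by auto
  have "((\<lambda>y. ((\<integral>u. f y u \<partial>M) - (\<integral>u. f x u \<partial>M)) / (y - x)) \<longlongrightarrow> (\<integral>u. f' x u \<partial>M)) (at x within ?S)"
    unfolding tendsto_at_iff_sequentially comp_def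
  proof (intro allI impI)
    fix X assume X: "\<forall>i. X i \<in> ?S - {x}" "X \<longlonglongrightarrow> x"
    then have Xi: "\<bar>X i - x\<bar> < \<delta>" "X i \<noteq> x" for i using S by blast+
    have [measurable]: "f y \<in> borel_measurable M" if "\<bar>y - x\<bar> < \<delta>" for y
      using int[OF that] by simp
    have "(\<lambda>i. \<integral>u. (f (X i) u - f x u) / (X i - x) \<partial>M) \<longlonglongrightarrow> (\<integral>u. f' x u \<partial>M)"
    proof (rule integral_dominated_convergence[where w = "\<lambda>_. B"])
      show "AE u in M. (\<lambda>i. (f (X i) u - f x u) / (X i - x)) \<longlonglongrightarrow> f' x u"
        using der
      proof eventually_elim
        case (elim u)
        then have "((\<lambda>y. f y u) has_real_derivative f' x u) (at x)" using \<delta> by auto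
        then have "((\<lambda>y. (f y u - f x u) / (y - x)) \<longlongrightarrow> f' x u) (at x)"
          by (simp add: has_field_derivative_iff)
        then show ?case
          using X(2) Xi(2) unfolding tendsto_at_iff_sequentially comp_def by simp
      qed
      show "AE u in M. norm ((f (X i) u - f x u) / (X i - x)) \<le> B" for i
        using der
      proof eventually_elim
        case (elim u)
        have "norm (f (X i) u - f x u) \<le> B * norm (X i - x)"
        proof (rule field_differentiable_bound[of ?S "\<lambda>y. f y u" "\<lambda>y. f' y u"])
          show "((\<lambda>y. f y u) has_field_derivative f' z u) (at z within ?S)" if "z \<in> ?S" for z
            using elim that S by (blast intro: has_field_derivative_at_within)
          show "norm (f' z u) \<le> B" if "z \<in> ?S" for z
            using elim that S by simp
        qed (use Xi \<delta> S in auto)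
        then show ?case using Xi(2)[of i] by (simp add: divide_le_eq)
      qed
    qed (use int Xi \<delta> in \<open>auto intro!: borel_measurable_divide borel_measurable_diff\<close>)
    moreover have "(\<integral>u. (f (X i) u - f x u) / (X i - x) \<partial>M)
        = ((\<integral>u. f (X i) u \<partial>M) - (\<integral>u. f x u \<partial>M)) / (X i - x)" for i
      using int[of "X i"] int[of x] Xi \<delta> by simp
    ultimately show "(\<lambda>i. ((\<integral>u. f (X i) u \<partial>M) - (\<integral>u. f x u \<partial>M)) / (X i - x))
        \<longlonglongrightarrow> (\<integral>u. f' x u \<partial>M)" by (simp only:)
  qed
  then show ?thesis
    using \<delta> by (simp add: has_field_derivative_iff at_within_open[of x ?S])
qed

definition reflect :: "'a::euclidean_space \<Rightarrow> 'a \<Rightarrow> 'a" where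
  "reflect w x = x - (2 * (x \<bullet> w) / (w \<bullet> w)) *\<^sub>R w"

lemma reflect_orthogonal: "orthogonal_transformation (reflect w)"
  unfolding orthogonal_transformation
proof
  show "linear (reflect w)"
    by (rule linearI) (simp_all add: reflect_def inner_add_left algebra_simps add_divide_distrib)
  have "(norm (reflect w x))\<^sup>2 = (norm x)\<^sup>2" for x
    unfolding power2_norm_eq_inner
    by (cases "w = 0") (simp_all add: reflect_def inner_diff_left inner_diff_right inner_commute field_simps)
  then show "\<forall>x. norm (reflect w x) = norm x" by simp
qed

lemma reflect_inner: "reflect w u \<bullet> y = u \<bullet> reflect w y"
  by (simp add: reflect_def inner_diff_left inner_diff_right inner_commute)

lemma reflect_perp: "w \<bullet> x = 0 \<Longrightarrow> reflect w x = x"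
  by (simp add: reflect_def inner_commute)

lemma reflect_minus: "reflect (y - x) = reflect (x - y)"
proof
  fix u
  have "reflect (- w) u = reflect w u" for w :: 'a by (simp add: reflect_def)
  from this[of "x - y"] show "reflect (y - x) u = reflect (x - y) u" by simp
qed

lemma reflect_swap:
  assumes "norm x = norm y"
  shows "reflect (x - y) x = y"
proof (cases "x = y")
  case False
  have xy: "x \<bullet> x = y \<bullet> y" using assms by (simp add: norm_eq_sqrt_inner)
  have "(x - y) \<bullet> (x - y) = 2 * (x \<bullet> (x - y))"
    by (simp add: inner_diff_left inner_diff_right xy inner_commute)
  moreover have "(x - y) \<bullet> (x - y) \<noteq> 0" using False by simp
  ultimately have "2 * (x \<bullet> (x - y)) / ((x - y) \<bullet> (x - y)) = 1" by (metis divide_self)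
  then show ?thesis by (simp only: reflect_def) simp
qed (simp add: reflect_def)

locale rotation_invariant_sphere = finite_measure \<sigma> for \<sigma> :: "'a::euclidean_space measure" +
  assumes sets_sphere: "sets \<sigma> = sets borel"
    and AE_norm: "AE x in \<sigma>. norm x = 1"
    and invariant: "\<And>T. orthogonal_transformation T \<Longrightarrow> distr \<sigma> borel T = \<sigma>"
    and dim: "DIM('a) \<ge> 2"
begin

lemma measurable_sphere: "f \<in> borel_measurable borel \<Longrightarrow> f \<in> borel_measurable \<sigma>"
  by (simp add: measurable_cong_sets[OF sets_sphere refl])

lemma integrable_sphere:
  fixes f :: "'a \<Rightarrow> real"
  assumes "f \<in> borel_measurable borel" "\<And>u. norm u = 1 \<Longrightarrow> \<bar>f u\<bar> \<le> B"
  shows "integrable \<sigma> f"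
  using measurable_sphere[OF assms(1)]
  by (rule integrable_const_bound[of _ B, rotated]) (use AE_norm assms(2) in auto)

lemma integral_cong_sphere:
  fixes f g :: "'a \<Rightarrow> real"
  assumes "f \<in> borel_measurable borel" "g \<in> borel_measurable borel"
    and "\<And>u. norm u = 1 \<Longrightarrow> f u = g u"
  shows "(\<integral>u. f u \<partial>\<sigma>) = (\<integral>u. g u \<partial>\<sigma>)"
  using measurable_sphere assms AE_norm by (intro integral_cong_AE) auto

lemma integral_orthogonal:
  fixes f :: "'a \<Rightarrow> real"
  assumes "orthogonal_transformation T" "f \<in> borel_measurable borel"
  shows "(\<integral>u. f (T u) \<partial>\<sigma>) = (\<integral>u. f u \<partial>\<sigma>)"
proof -
  have "T \<in> borel_measurable borel"
    using orthogonal_transformation_linear[OF assms(1)]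
    by (intro borel_measurable_continuous_onI linear_continuous_on) (simp add: linear_conv_bounded_linear)
  then have "(\<integral>u. f u \<partial>distr \<sigma> borel T) = (\<integral>u. f (T u) \<partial>\<sigma>)"
    by (intro integral_distr measurable_sphere assms)
  then show ?thesis by (simp add: invariant[OF assms(1)])
qed

lemma integral_swap:
  fixes h :: "real \<Rightarrow> real \<Rightarrow> real"
  assumes "norm x = norm y" "x \<bullet> e = y \<bullet> e" "(\<lambda>u. h (u \<bullet> e) (u \<bullet> y)) \<in> borel_measurable borel"
  shows "(\<integral>u. h (u \<bullet> e) (u \<bullet> x) \<partial>\<sigma>) = (\<integral>u. h (u \<bullet> e) (u \<bullet> y) \<partial>\<sigma>)"
proof -
  let ?R = "reflect (x - y)"
  have "?R y = x"
    using reflect_swap[of y x] assms(1) by (simp add: reflect_minus)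
  moreover have "?R e = e" using assms(2) by (intro reflect_perp) (simp add: inner_diff_left)
  ultimately show ?thesis
    using integral_orthogonal[OF reflect_orthogonal assms(3), of "x - y"] by (simp add: reflect_inner)
qed

lemma unit_inner_le: "norm u = 1 \<Longrightarrow> \<bar>u \<bullet> x\<bar> \<le> norm x"
  using Cauchy_Schwarz_ineq2[of u x] by simp

lemma zonal_integrable:
  assumes [measurable]: "g \<in> borel_measurable borel" and "\<And>s. \<bar>s\<bar> \<le> 1 \<Longrightarrow> \<bar>g s\<bar> \<le> B" and e: "norm e = 1"
  shows "integrable \<sigma> (\<lambda>u. g (u \<bullet> e))" "integrable \<sigma> (\<lambda>u. g (u \<bullet> e) * (u \<bullet> y))"
    "integrable \<sigma> (\<lambda>u. g (u \<bullet> e) * ((u \<bullet> y) * (u \<bullet> z)))"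
proof -
  have gB: "\<bar>g (u \<bullet> e)\<bar> \<le> B" if "norm u = 1" for u
    using unit_inner_le[OF that, of e] assms(2) e by simp
  then show "integrable \<sigma> (\<lambda>u. g (u \<bullet> e))" by (intro integrable_sphere[of _ B]) auto
  have B: "B \<ge> 0" using assms(2)[of 0] by simp
  show "integrable \<sigma> (\<lambda>u. g (u \<bullet> e) * (u \<bullet> y))"
    by (rule integrable_sphere[of _ "B * norm y"])
      (auto simp: abs_mult intro!: mult_mono gB unit_inner_le B)
  show "integrable \<sigma> (\<lambda>u. g (u \<bullet> e) * ((u \<bullet> y) * (u \<bullet> z)))"
    by (rule integrable_sphere[of _ "B * (norm y * norm z)"])
      (auto simp: abs_mult intro!: mult_mono gB unit_inner_le B)
qed

context
  fixes g :: "real \<Rightarrow> real" and e :: 'a and B A M1 M2 :: real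
  assumes g[measurable]: "g \<in> borel_measurable borel" and gB: "\<And>s. \<bar>s\<bar> \<le> 1 \<Longrightarrow> \<bar>g s\<bar> \<le> B"
    and e: "norm e = 1"
  defines "A \<equiv> \<integral>u. g (u \<bullet> e) \<partial>\<sigma>"
    and "M1 \<equiv> \<integral>u. g (u \<bullet> e) * (u \<bullet> e) \<partial>\<sigma>"
    and "M2 \<equiv> \<integral>u. g (u \<bullet> e) * ((u \<bullet> e) * (u \<bullet> e)) \<partial>\<sigma>"
begin

lemma unit_inner_self: "e \<bullet> e = 1"
  using e by (simp add: dot_square_norm)

lemma zonal_odd:
  assumes "z \<bullet> e = 0"
  shows "(\<integral>u. g (u \<bullet> e) * (u \<bullet> z) \<partial>\<sigma>) = 0" "(\<integral>u. g (u \<bullet> e) * ((u \<bullet> e) * (u \<bullet> z)) \<partial>\<sigma>) = 0"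
  using integral_swap[of z "- z" e "\<lambda>a b. g a * b"] integral_swap[of z "- z" e "\<lambda>a b. g a * (a * b)"] assms
  by auto

lemma zonal_first:
  "(\<integral>u. g (u \<bullet> e) * (u \<bullet> y) \<partial>\<sigma>) = (y \<bullet> e) * M1"
proof -
  define z where "z = y - (y \<bullet> e) *\<^sub>R e"
  have z: "z \<bullet> e = 0" by (simp add: z_def inner_diff_left unit_inner_self)
  have "g (u \<bullet> e) * (u \<bullet> y) = (y \<bullet> e) * (g (u \<bullet> e) * (u \<bullet> e)) + g (u \<bullet> e) * (u \<bullet> z)" for u
    by (simp add: z_def inner_diff_right algebra_simps)
  then show ?thesis
    using zonal_integrable[OF g gB e] zonal_odd[OF z] by (simp add: M1_def)
qed

lemma sum_Basis_zonal:
  "(\<Sum>b\<in>Basis. \<integral>u. g (u \<bullet> e) * ((u \<bullet> b) * (u \<bullet> b)) \<partial>\<sigma>) = A"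
proof -
  have "(\<Sum>b\<in>Basis. \<integral>u. g (u \<bullet> e) * ((u \<bullet> b) * (u \<bullet> b)) \<partial>\<sigma>)
      = (\<integral>u. g (u \<bullet> e) * (u \<bullet> u) \<partial>\<sigma>)"
    using zonal_integrable[OF g gB e]
    by (subst Bochner_Integration.integral_sum[symmetric])
      (auto simp: sum_distrib_left[symmetric] intro!: Bochner_Integration.integral_cong euclidean_inner[symmetric])
  also have "\<dots> = A"
    unfolding A_def by (rule integral_cong_sphere) (auto simp: dot_square_norm)
  finally show ?thesis .
qed

lemma zonal_perp:
  assumes z: "z \<bullet> e = 0"
  shows "(\<integral>u. g (u \<bullet> e) * ((u \<bullet> z) * (u \<bullet> z)) \<partial>\<sigma>) * (DIM('a) - 1) = (z \<bullet> z) * (A - M2)"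
proof -
  define q where "q y = (\<integral>u. g (u \<bullet> e) * ((u \<bullet> y) * (u \<bullet> y)) \<partial>\<sigma>)" for y
  have q_scale: "q (c *\<^sub>R y) = c\<^sup>2 * q y" for c y
    unfolding q_def Bochner_Integration.integral_mult_right_zero[symmetric]
    by (intro Bochner_Integration.integral_cong) (auto simp: power2_eq_square)
  have q_perp: "q y * (z \<bullet> z) = q z * (y \<bullet> y)" if y: "y \<bullet> e = 0" for y
  proof -
    have "q (norm z *\<^sub>R y) = q (norm y *\<^sub>R z)"
      unfolding q_def using y z by (intro integral_swap[of _ _ e "\<lambda>a b. g a * (b * b)"]) auto
    then show ?thesis by (simp add: q_scale power2_norm_eq_inner mult.commute)
  qed
  define p where "p b = b - (b \<bullet> e) *\<^sub>R e" for b
  have pe: "p b \<bullet> e = 0" for b by (simp add: p_def inner_diff_left unit_inner_self)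
  have pp: "p b \<bullet> p b = 1 - (b \<bullet> e)\<^sup>2" if "b \<in> Basis" for b
    using that by (simp add: p_def inner_diff_left inner_diff_right unit_inner_self inner_commute power2_eq_square)
  have qp: "q (p b) = q b - (b \<bullet> e)\<^sup>2 * M2" for b
  proof -
    have "g (u \<bullet> e) * ((u \<bullet> b) * (u \<bullet> b)) = g (u \<bullet> e) * ((u \<bullet> p b) * (u \<bullet> p b))
        + ((2 * (b \<bullet> e)) * (g (u \<bullet> e) * ((u \<bullet> e) * (u \<bullet> p b)))
        + (b \<bullet> e)\<^sup>2 * (g (u \<bullet> e) * ((u \<bullet> e) * (u \<bullet> e))))" for u
      by (simp add: p_def inner_diff_right power2_eq_square algebra_simps)
    then show ?thesis
      using zonal_integrable[OF g gB e] zonal_odd[OF pe[of b]]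
      by (simp add: q_def M2_def)
  qed
  have sum_e: "(\<Sum>b\<in>Basis. (b \<bullet> e)\<^sup>2) = 1"
    using euclidean_inner[of e e] by (simp add: unit_inner_self power2_eq_square inner_commute)
  have "(\<Sum>b\<in>Basis. p b \<bullet> p b) = (\<Sum>b\<in>Basis. 1 - (b \<bullet> e)\<^sup>2)"
    by (intro sum.cong refl pp)
  then have 1: "(\<Sum>b\<in>Basis. p b \<bullet> p b) = real (DIM('a) - 1)"
    unfolding sum_subtractf sum_e using dim by (simp only: sum_constant of_nat_diff)
  have "(\<Sum>b\<in>Basis. q (p b)) = (\<Sum>b\<in>Basis. q b - (b \<bullet> e)\<^sup>2 * M2)"
    by (simp add: qp)
  then have 2: "(\<Sum>b\<in>Basis. q (p b)) = A - M2"
    using sum_Basis_zonal sum_e by (simp add: sum_subtractf q_def flip: sum_distrib_right)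
  have "(\<Sum>b\<in>Basis. q (p b) * (z \<bullet> z)) = (\<Sum>b\<in>Basis. q z * (p b \<bullet> p b))"
    by (intro sum.cong refl q_perp pe)
  then have "q z * (\<Sum>b\<in>Basis. p b \<bullet> p b) = (\<Sum>b\<in>Basis. q (p b)) * (z \<bullet> z)"
    by (simp only: sum_distrib_left sum_distrib_right)
  then show ?thesis unfolding 1 2 by (simp add: q_def mult.commute)
qed

lemma zonal_second_same:
  "(\<integral>u. g (u \<bullet> e) * ((u \<bullet> y) * (u \<bullet> y)) \<partial>\<sigma>)
    = (y \<bullet> e)\<^sup>2 * M2 + (y \<bullet> y - (y \<bullet> e)\<^sup>2) * ((A - M2) / (DIM('a) - 1))"
proof -
  define z where "z = y - (y \<bullet> e) *\<^sub>R e"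
  have z: "z \<bullet> e = 0" by (simp add: z_def inner_diff_left unit_inner_self)
  have zz: "z \<bullet> z = y \<bullet> y - (y \<bullet> e)\<^sup>2"
    by (simp add: z_def inner_diff_left inner_diff_right unit_inner_self inner_commute power2_eq_square)
  have "g (u \<bullet> e) * ((u \<bullet> y) * (u \<bullet> y)) = g (u \<bullet> e) * ((u \<bullet> z) * (u \<bullet> z))
      + ((2 * (y \<bullet> e)) * (g (u \<bullet> e) * ((u \<bullet> e) * (u \<bullet> z)))
      + (y \<bullet> e)\<^sup>2 * (g (u \<bullet> e) * ((u \<bullet> e) * (u \<bullet> e))))" for u
    by (simp add: z_def inner_diff_right power2_eq_square algebra_simps)
  then have "(\<integral>u. g (u \<bullet> e) * ((u \<bullet> y) * (u \<bullet> y)) \<partial>\<sigma>)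
      = (\<integral>u. g (u \<bullet> e) * ((u \<bullet> z) * (u \<bullet> z)) \<partial>\<sigma>) + (y \<bullet> e)\<^sup>2 * M2"
    using zonal_integrable[OF g gB e] zonal_odd[OF z] by (simp add: M2_def)
  moreover have "(\<integral>u. g (u \<bullet> e) * ((u \<bullet> z) * (u \<bullet> z)) \<partial>\<sigma>) = (z \<bullet> z) * ((A - M2) / (DIM('a) - 1))"
    using zonal_perp[OF z] dim by (simp add: field_simps)
  ultimately show ?thesis by (simp add: zz)
qed

lemma zonal_second:
  "(\<integral>u. g (u \<bullet> e) * ((u \<bullet> y) * (u \<bullet> z)) \<partial>\<sigma>)
    = (y \<bullet> e) * (z \<bullet> e) * M2 + (y \<bullet> z - (y \<bullet> e) * (z \<bullet> e)) * ((A - M2) / (DIM('a) - 1))"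
proof -
  let ?I = "\<lambda>x u. g (u \<bullet> e) * ((u \<bullet> x) * (u \<bullet> x))"
  have "g (u \<bullet> e) * ((u \<bullet> y) * (u \<bullet> z)) = (?I (y + z) u - ?I (y - z) u) / 4" for u
    by (simp add: inner_add_right inner_diff_right algebra_simps)
  then have "(\<integral>u. g (u \<bullet> e) * ((u \<bullet> y) * (u \<bullet> z)) \<partial>\<sigma>)
      = (\<integral>u. (?I (y + z) u - ?I (y - z) u) / 4 \<partial>\<sigma>)" by (simp only:)
  also have "\<dots> = ((\<integral>u. ?I (y + z) u \<partial>\<sigma>) - (\<integral>u. ?I (y - z) u \<partial>\<sigma>)) / 4"
    using zonal_integrable[OF g gB e] by simp
  finally have "(\<integral>u. g (u \<bullet> e) * ((u \<bullet> y) * (u \<bullet> z)) \<partial>\<sigma>)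
      = ((\<integral>u. ?I (y + z) u \<partial>\<sigma>) - (\<integral>u. ?I (y - z) u \<partial>\<sigma>)) / 4" .
  moreover define k where "k = (A - M2) / (DIM('a) - 1)"
  ultimately show ?thesis
    unfolding zonal_second_same k_def[symmetric]
    by (simp add: inner_add_left inner_diff_left inner_add_right inner_diff_right inner_commute power2_eq_square algebra_simps)
qed

end

end

section \<open>Moments of the sphere and of the Poisson kernel\<close>

lemma continuous_on_unit_interval_bounded:
  fixes g :: "real \<Rightarrow> real"
  assumes "continuous_on {-1..1} g"
  obtains B where "\<And>s. \<bar>s\<bar> \<le> 1 \<Longrightarrow> \<bar>g s\<bar> \<le> B"
proof -
  have "bounded (g ` {-1..1})"
    using assms by (intro compact_imp_bounded compact_continuous_image) auto
  then obtain B where "\<forall>x\<in>g ` {-1..1}. norm x \<le> B" by (auto simp only: bounded_iff)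
  then have "\<bar>g s\<bar> \<le> B" if "\<bar>s\<bar> \<le> 1" for s
    using that by (simp add: abs_le_iff)
  then show thesis by (rule that)
qed

context rotation_invariant_sphere
begin

lemma obtain_perp_unit:
  obtains z :: 'a where "norm z = 1" "z \<bullet> e = 0"
proof -
  obtain y :: 'a where y: "y \<noteq> 0" "orthogonal e y"
    using orthogonal_to_vector_exists[OF dim, of e] by blast
  have "norm (sgn y) = 1" using y(1) by (simp add: norm_sgn)
  moreover have "sgn y \<bullet> e = 0" using y(2) by (simp add: sgn_div_norm orthogonal_def inner_commute)
  ultimately show thesis by (rule that)
qed

text \<open>Integration by parts on the sphere: differentiate the integral of \<open>g (u \<bullet> e) * (u \<bullet> z)\<close>
  along rotations in the plane of \<open>e\<close> and \<open>z\<close>, under which it is constant.\<close>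

lemma zonal_by_parts:
  assumes [measurable]: "g \<in> borel_measurable borel" "g' \<in> borel_measurable borel"
    and der: "\<And>s. \<bar>s\<bar> \<le> 1 \<Longrightarrow> (g has_real_derivative g' s) (at s)"
    and cont: "continuous_on {-1..1} g'" and e: "norm e = 1"
  shows "(\<integral>u. g' (u \<bullet> e) * (1 - (u \<bullet> e)\<^sup>2) \<partial>\<sigma>) = (DIM('a) - 1) * (\<integral>u. g (u \<bullet> e) * (u \<bullet> e) \<partial>\<sigma>)"
proof -
  have "continuous_on {-1..1} g"
  proof (rule DERIV_continuous_on)
    show "(g has_real_derivative g' s) (at s within {-1..1})" if "s \<in> {-1..1}" for s
      using that by (intro has_field_derivative_at_within[OF der]) (simp add: abs_le_iff)
  qed
  from continuous_on_unit_interval_bounded[OF this]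
  obtain B where B: "\<And>s. \<bar>s\<bar> \<le> 1 \<Longrightarrow> \<bar>g s\<bar> \<le> B" by blast
  from continuous_on_unit_interval_bounded[OF cont]
  obtain B' where B': "\<And>s. \<bar>s\<bar> \<le> 1 \<Longrightarrow> \<bar>g' s\<bar> \<le> B'" by blast
  have B0: "B \<ge> 0" "B' \<ge> 0" using B[of 0] B'[of 0] by auto
  obtain z :: 'a where z: "norm z = 1" "z \<bullet> e = 0" using obtain_perp_unit[of e] by blast
  have inn: "e \<bullet> e = 1" "z \<bullet> z = 1" "e \<bullet> z = 0" "z \<bullet> e = 0"
    using e z inner_commute[of e z] by (simp_all add: dot_square_norm)
  define a where "a \<theta> u = cos \<theta> * (u \<bullet> e) - sin \<theta> * (u \<bullet> z)" for \<theta> u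
  define b where "b \<theta> u = sin \<theta> * (u \<bullet> e) + cos \<theta> * (u \<bullet> z)" for \<theta> u
  define T where "T \<theta> u = u + (a \<theta> u - u \<bullet> e) *\<^sub>R e + (b \<theta> u - u \<bullet> z) *\<^sub>R z" for \<theta> u
  have Te: "T \<theta> u \<bullet> e = a \<theta> u" and Tz: "T \<theta> u \<bullet> z = b \<theta> u" for \<theta> u
    by (simp_all add: T_def inner_add_left inn)
  have T: "orthogonal_transformation (T \<theta>)" for \<theta>
    unfolding orthogonal_transformation
  proof
    show "linear (T \<theta>)"
      by (rule linearI) (simp_all add: T_def a_def b_def inner_add_left algebra_simps)
    have ab: "(a \<theta> u)\<^sup>2 + (b \<theta> u)\<^sup>2 = (u \<bullet> e)\<^sup>2 + (u \<bullet> z)\<^sup>2" for u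
    proof -
      have "(a \<theta> u)\<^sup>2 + (b \<theta> u)\<^sup>2 = ((sin \<theta>)\<^sup>2 + (cos \<theta>)\<^sup>2) * ((u \<bullet> e)\<^sup>2 + (u \<bullet> z)\<^sup>2)"
        unfolding a_def b_def power2_eq_square by algebra
      then show ?thesis by simp
    qed
    have "(norm (T \<theta> u))\<^sup>2 = (norm u)\<^sup>2" for u
    proof -
      have "(norm (T \<theta> u))\<^sup>2 = (norm u)\<^sup>2 + ((a \<theta> u)\<^sup>2 + (b \<theta> u)\<^sup>2) - ((u \<bullet> e)\<^sup>2 + (u \<bullet> z)\<^sup>2)"
        unfolding power2_norm_eq_inner
        by (simp add: T_def inner_add_left inner_add_right inn inner_commute[of e u] inner_commute[of z u]
            power2_eq_square algebra_simps)
      then show ?thesis by (simp add: ab)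
    qed
    then show "\<forall>u. norm (T \<theta> u) = norm u" by simp
  qed
  have ab_le: "\<bar>a \<theta> u\<bar> \<le> 1" "\<bar>b \<theta> u\<bar> \<le> 1" if "norm u = 1" for \<theta> u
    using unit_inner_le[of "T \<theta> u" e] unit_inner_le[of "T \<theta> u" z] that orthogonal_transformation_norm[OF T]
    by (simp_all add: Te Tz e z)
  have [measurable]: "(a \<theta> :: 'a \<Rightarrow> real) \<in> borel_measurable borel" "(b \<theta> :: 'a \<Rightarrow> real) \<in> borel_measurable borel" for \<theta>
    by (simp_all add: a_def[abs_def] b_def[abs_def])
  have cmp: "(\<lambda>u::'a. g (a \<theta> u) * b \<theta> u) \<in> borel_measurable borel"
    "(\<lambda>u::'a. g' (a \<theta> u) * (- b \<theta> u) * b \<theta> u + g (a \<theta> u) * a \<theta> u) \<in> borel_measurable borel" for \<theta>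
    by measurable
  have "((\<lambda>\<theta>. \<integral>u. g (a \<theta> u) * b \<theta> u \<partial>\<sigma>) has_real_derivative
      (\<integral>u. g' (a 0 u) * (- b 0 u) * b 0 u + g (a 0 u) * a 0 u \<partial>\<sigma>)) (at 0)"
  proof (rule has_real_derivative_integral[where \<delta> = 1 and B = "B' + B"
        and f' = "\<lambda>\<theta> u. g' (a \<theta> u) * (- b \<theta> u) * b \<theta> u + g (a \<theta> u) * a \<theta> u"])
    show "finite_measure \<sigma>" by (rule finite_measure_axioms)
    show "AE u in \<sigma>. \<forall>\<theta>. \<bar>\<theta> - 0\<bar> < 1 \<longrightarrow>
       ((\<lambda>\<theta>. g (a \<theta> u) * b \<theta> u) has_real_derivative
         (g' (a \<theta> u) * (- b \<theta> u) * b \<theta> u + g (a \<theta> u) * a \<theta> u)) (at \<theta>) \<and>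
       \<bar>g' (a \<theta> u) * (- b \<theta> u) * b \<theta> u + g (a \<theta> u) * a \<theta> u\<bar> \<le> B' + B"
      using AE_norm
    proof (eventually_elim, intro allI impI conjI)
      fix u :: 'a and \<theta> assume u: "norm u = 1"
      have da: "((\<lambda>\<theta>. a \<theta> u) has_real_derivative - b \<theta> u) (at \<theta>)"
        and db: "((\<lambda>\<theta>. b \<theta> u) has_real_derivative a \<theta> u) (at \<theta>)"
        unfolding a_def b_def by (auto intro!: derivative_eq_intros)
      have "((\<lambda>\<theta>. g (a \<theta> u)) has_real_derivative g' (a \<theta> u) * (- b \<theta> u)) (at \<theta>)"
        by (rule DERIV_chain2[OF der da]) (rule ab_le[OF u])
      from DERIV_mult[OF this db]
      show "((\<lambda>\<theta>. g (a \<theta> u) * b \<theta> u) has_real_derivative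
         (g' (a \<theta> u) * (- b \<theta> u) * b \<theta> u + g (a \<theta> u) * a \<theta> u)) (at \<theta>)"
        by (simp add: mult.commute)
      have "\<bar>g' (a \<theta> u)\<bar> * (\<bar>b \<theta> u\<bar> * \<bar>b \<theta> u\<bar>) \<le> B' * (1 * 1)"
        using ab_le[OF u] B0 by (intro mult_mono B') auto
      moreover have "\<bar>g (a \<theta> u)\<bar> * \<bar>a \<theta> u\<bar> \<le> B * 1"
        using ab_le[OF u] B0 by (intro mult_mono B) auto
      ultimately have "\<bar>g' (a \<theta> u) * (- b \<theta> u) * b \<theta> u\<bar> \<le> B'" "\<bar>g (a \<theta> u) * a \<theta> u\<bar> \<le> B"
        by (simp_all only: abs_mult abs_minus_cancel mult.assoc mult_1_right)
      then show "\<bar>g' (a \<theta> u) * (- b \<theta> u) * b \<theta> u + g (a \<theta> u) * a \<theta> u\<bar> \<le> B' + B" by linarith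
    qed
    show "integrable \<sigma> (\<lambda>u. g (a \<theta> u) * b \<theta> u)" for \<theta>
    proof (rule integrable_sphere[OF cmp(1), of _ "B * 1"])
      show "\<bar>g (a \<theta> u) * b \<theta> u\<bar> \<le> B * 1" if "norm u = 1" for u
        unfolding abs_mult using ab_le[OF that] B0 by (intro mult_mono B) auto
    qed
    show "(\<lambda>u. g' (a 0 u) * (- b 0 u) * b 0 u + g (a 0 u) * a 0 u) \<in> borel_measurable \<sigma>"
      by (rule measurable_sphere[OF cmp(2)])
  qed simp
  moreover have "(\<integral>u. g (a \<theta> u) * b \<theta> u \<partial>\<sigma>) = (\<integral>u. g (u \<bullet> e) * (u \<bullet> z) \<partial>\<sigma>)" for \<theta>
    using integral_orthogonal[OF T[of \<theta>], of "\<lambda>u. g (u \<bullet> e) * (u \<bullet> z)"] by (simp add: Te Tz)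
  ultimately have "((\<lambda>\<theta>::real. \<integral>u. g (u \<bullet> e) * (u \<bullet> z) \<partial>\<sigma>) has_real_derivative
      (\<integral>u. g' (a 0 u) * (- b 0 u) * b 0 u + g (a 0 u) * a 0 u \<partial>\<sigma>)) (at 0)" by simp
  then have "(\<integral>u. g' (a 0 u) * (- b 0 u) * b 0 u + g (a 0 u) * a 0 u \<partial>\<sigma>) = 0"
    using DERIV_unique DERIV_const by blast
  then have "(\<integral>u. g (u \<bullet> e) * (u \<bullet> e) - g' (u \<bullet> e) * ((u \<bullet> z) * (u \<bullet> z)) \<partial>\<sigma>) = 0"
    by (simp add: a_def b_def algebra_simps)
  moreover note int = zonal_integrable[OF assms(2) B' e] zonal_integrable[OF assms(1) B e]
  ultimately have "(\<integral>u. g' (u \<bullet> e) * ((u \<bullet> z) * (u \<bullet> z)) \<partial>\<sigma>) = (\<integral>u. g (u \<bullet> e) * (u \<bullet> e) \<partial>\<sigma>)"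
    by simp
  moreover have "(\<integral>u. g' (u \<bullet> e) * ((u \<bullet> z) * (u \<bullet> z)) \<partial>\<sigma>) * (DIM('a) - 1)
      = (\<integral>u. g' (u \<bullet> e) \<partial>\<sigma>) - (\<integral>u. g' (u \<bullet> e) * ((u \<bullet> e) * (u \<bullet> e)) \<partial>\<sigma>)"
    using zonal_perp[OF assms(2) B' e z(2)] by (simp add: inn)
  moreover have "(\<integral>u. g' (u \<bullet> e) * (1 - (u \<bullet> e)\<^sup>2) \<partial>\<sigma>)
      = (\<integral>u. g' (u \<bullet> e) \<partial>\<sigma>) - (\<integral>u. g' (u \<bullet> e) * ((u \<bullet> e) * (u \<bullet> e)) \<partial>\<sigma>)"
    using int by (simp add: right_diff_distrib power2_eq_square)
  ultimately show ?thesis by (simp add: mult.commute)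
qed

abbreviation total :: real where "total \<equiv> measure \<sigma> (space \<sigma>)"

lemma abs_power_le_one: "\<bar>s\<bar> \<le> 1 \<Longrightarrow> \<bar>s ^ k\<bar> \<le> (1 :: real)"
  by (simp add: power_abs power_le_one)

lemma second_moment:
  "(\<integral>u. (u \<bullet> y) * (u \<bullet> z) \<partial>\<sigma>) = (y \<bullet> z) * total / DIM('a)"
proof -
  obtain e :: 'a where e: "norm e = 1" by (rule obtain_perp_unit[of 0])
  let ?M = "\<integral>u. (u \<bullet> e) * (u \<bullet> e) \<partial>\<sigma>"
  have int: "integrable \<sigma> (\<lambda>u. (u \<bullet> e) * (u \<bullet> e))"
    using zonal_integrable(3)[of "\<lambda>_. 1" 1 e] e by simp
  have "(\<integral>u. 1 - (u \<bullet> e)\<^sup>2 \<partial>\<sigma>) = (DIM('a) - 1) * ?M"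
    using zonal_by_parts[of "\<lambda>s. s" "\<lambda>_. 1" e] e by simp
  then have "total - ?M = (DIM('a) - 1) * ?M"
    using int by (simp add: power2_eq_square)
  then have M: "?M * DIM('a) = total" using dim by (simp add: of_nat_diff algebra_simps)
  have "(\<integral>u. (u \<bullet> y) * (u \<bullet> z) \<partial>\<sigma>)
      = (y \<bullet> e) * (z \<bullet> e) * ?M + (y \<bullet> z - (y \<bullet> e) * (z \<bullet> e)) * ((total - ?M) / (DIM('a) - 1))"
    using zonal_second[of "\<lambda>_. 1" 1 e y z] e by simp
  also have "(total - ?M) / (DIM('a) - 1) = ?M"
    using dim by (simp add: M[symmetric] field_simps of_nat_diff)
  also have "?M = total / DIM('a)" using M dim by (simp add: field_simps)
  finally show ?thesis using dim by (simp add: field_simps)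
qed

lemma fourth_moment_unit:
  assumes e: "norm e = 1"
  shows "(\<integral>u. (u \<bullet> e)\<^sup>2 * ((u \<bullet> y) * (u \<bullet> z)) \<partial>\<sigma>)
    = (2 * (y \<bullet> e) * (z \<bullet> e) + y \<bullet> z) * (total / (real DIM('a) * (real DIM('a) + 2)))"
proof -
  let ?d = "real DIM('a)"
  let ?A = "\<integral>u. (u \<bullet> e)\<^sup>2 \<partial>\<sigma>" and ?M = "\<integral>u. (u \<bullet> e)\<^sup>2 * ((u \<bullet> e) * (u \<bullet> e)) \<partial>\<sigma>"
  have d: "?d \<ge> 2" using dim by simp
  have e1: "e \<bullet> e = 1" using e by (simp add: dot_square_norm)
  have int: "integrable \<sigma> (\<lambda>u. (u \<bullet> e)\<^sup>2)" "integrable \<sigma> (\<lambda>u. (u \<bullet> e)\<^sup>2 * ((u \<bullet> e) * (u \<bullet> e)))"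
    using zonal_integrable[of "\<lambda>s. s\<^sup>2" 1 e] e abs_power_le_one[of _ 2] by auto
  have A: "?A = total / ?d"
    using second_moment[of e e] e1 by (simp add: power2_eq_square)
  have "(\<integral>u. (3 * (u \<bullet> e)\<^sup>2) * (1 - (u \<bullet> e)\<^sup>2) \<partial>\<sigma>) = (DIM('a) - 1) * (\<integral>u. (u \<bullet> e) ^ 3 * (u \<bullet> e) \<partial>\<sigma>)"
    using e by (intro zonal_by_parts[of "\<lambda>s. s ^ 3" "\<lambda>s. 3 * s\<^sup>2" e])
      (auto intro!: derivative_eq_intros continuous_intros)
  also have "(\<lambda>u. (3 * (u \<bullet> e)\<^sup>2) * (1 - (u \<bullet> e)\<^sup>2))
      = (\<lambda>u. 3 * (u \<bullet> e)\<^sup>2 - 3 * ((u \<bullet> e)\<^sup>2 * ((u \<bullet> e) * (u \<bullet> e))))"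
    by (simp add: power2_eq_square algebra_simps)
  also have "(\<lambda>u. (u \<bullet> e) ^ 3 * (u \<bullet> e)) = (\<lambda>u. (u \<bullet> e)\<^sup>2 * ((u \<bullet> e) * (u \<bullet> e)))"
    by (simp add: power2_eq_square power3_eq_cube mult.assoc)
  finally have "3 * ?A - 3 * ?M = (?d - 1) * ?M"
    using int dim by (simp add: of_nat_diff)
  then have "(?d + 2) * ?M = 3 * (total / ?d)"
    by (simp add: A algebra_simps)
  then have "?M = 3 * (total / ?d) / (?d + 2)"
    using d by (simp only: eq_divide_eq) (simp add: mult.commute)
  then have M: "?M = 3 * (total / (?d * (?d + 2)))"
    by simp
  define k where "k = total / (?d * (?d + 2))"
  have C: "(?A - ?M) / (?d - 1) = total / (?d * (?d + 2))"
    unfolding A M using d by (simp add: divide_simps) (simp add: algebra_simps)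
  have "(\<integral>u. (u \<bullet> e)\<^sup>2 * ((u \<bullet> y) * (u \<bullet> z)) \<partial>\<sigma>)
      = (y \<bullet> e) * (z \<bullet> e) * ?M + (y \<bullet> z - (y \<bullet> e) * (z \<bullet> e)) * ((?A - ?M) / (?d - 1))"
    using zonal_second[of "\<lambda>s. s\<^sup>2" 1 e y z] e abs_power_le_one[of _ 2] dim by (simp add: of_nat_diff)
  then have "(\<integral>u. (u \<bullet> e)\<^sup>2 * ((u \<bullet> y) * (u \<bullet> z)) \<partial>\<sigma>)
      = (y \<bullet> e) * (z \<bullet> e) * (3 * k) + (y \<bullet> z - (y \<bullet> e) * (z \<bullet> e)) * k"
    unfolding C unfolding M k_def .
  moreover have "total / (real DIM('a) * (real DIM('a) + 2)) = k" by (simp add: k_def)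
  ultimately show ?thesis by (simp only:) (simp add: algebra_simps)
qed

lemma fourth_moment_integrable:
  "integrable \<sigma> (\<lambda>u. (u \<bullet> x) * (u \<bullet> w) * ((u \<bullet> y) * (u \<bullet> z)))"
proof (rule integrable_sphere[of _ "(norm x * norm w) * (norm y * norm z)"])
  show "\<bar>(u \<bullet> x) * (u \<bullet> w) * ((u \<bullet> y) * (u \<bullet> z))\<bar> \<le> (norm x * norm w) * (norm y * norm z)"
    if "norm u = 1" for u
    unfolding abs_mult by (intro mult_mono unit_inner_le[OF that] mult_nonneg_nonneg) auto
qed simp

lemma fourth_moment:
  "(\<integral>u. (u \<bullet> x) * (u \<bullet> w) * ((u \<bullet> y) * (u \<bullet> z)) \<partial>\<sigma>)
    = ((x \<bullet> w) * (y \<bullet> z) + (x \<bullet> y) * (w \<bullet> z) + (x \<bullet> z) * (w \<bullet> y)) * (total / (real DIM('a) * (real DIM('a) + 2)))"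
proof -
  define c where "c = total / (real DIM('a) * (real DIM('a) + 2))"
  have same: "(\<integral>u. (u \<bullet> x) * (u \<bullet> x) * ((u \<bullet> y) * (u \<bullet> z)) \<partial>\<sigma>)
      = (2 * (y \<bullet> x) * (z \<bullet> x) + (x \<bullet> x) * (y \<bullet> z)) * c" for x
  proof (cases "x = 0")
    case False
    have x: "x = norm x *\<^sub>R sgn x" using False by (simp add: sgn_div_norm)
    define k e where "k = norm x" and "e = sgn x"
    have ke: "x = k *\<^sub>R e" "norm e = 1" "e \<bullet> e = 1"
      using x False by (auto simp: k_def e_def norm_sgn dot_square_norm)
    have "(\<integral>u. (u \<bullet> x) * (u \<bullet> x) * ((u \<bullet> y) * (u \<bullet> z)) \<partial>\<sigma>)
        = (\<integral>u. k\<^sup>2 * ((u \<bullet> e)\<^sup>2 * ((u \<bullet> y) * (u \<bullet> z))) \<partial>\<sigma>)"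
      by (simp add: ke(1) power2_eq_square mult_ac)
    also have "\<dots> = k\<^sup>2 * ((2 * (y \<bullet> e) * (z \<bullet> e) + y \<bullet> z) * c)"
      by (simp add: fourth_moment_unit[OF ke(2)] c_def)
    finally show ?thesis by (simp add: ke(1,3) power2_eq_square algebra_simps)
  qed simp
  let ?I = "\<lambda>x u. (u \<bullet> x) * (u \<bullet> x) * ((u \<bullet> y) * (u \<bullet> z))"
  have "(u \<bullet> x) * (u \<bullet> w) * ((u \<bullet> y) * (u \<bullet> z)) = (?I (x + w) u - ?I (x - w) u) / 4" for u
    by (simp add: inner_add_right inner_diff_right algebra_simps)
  then have "(\<integral>u. (u \<bullet> x) * (u \<bullet> w) * ((u \<bullet> y) * (u \<bullet> z)) \<partial>\<sigma>)
      = (\<integral>u. (?I (x + w) u - ?I (x - w) u) / 4 \<partial>\<sigma>)" by (simp only:)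
  also have "\<dots> = ((\<integral>u. ?I (x + w) u \<partial>\<sigma>) - (\<integral>u. ?I (x - w) u \<partial>\<sigma>)) / 4"
    using fourth_moment_integrable by simp
  finally show ?thesis
    unfolding same c_def[symmetric]
    by (simp add: inner_add_left inner_diff_left inner_add_right inner_diff_right inner_commute algebra_simps)
qed

end

definition poisson_base :: "real \<Rightarrow> real \<Rightarrow> real" where
  "poisson_base r s = 1 - 2 * r * s + r\<^sup>2"

lemma poisson_base_pos:
  assumes "\<bar>r\<bar> < 1" "\<bar>s\<bar> \<le> 1"
  shows "poisson_base r s > 0"
proof -
  have "r * s \<le> \<bar>r\<bar>"
    using assms abs_ge_self[of "r * s"] mult_left_mono[of "\<bar>s\<bar>" 1 "\<bar>r\<bar>"] by (simp add: abs_mult)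
  moreover have "(1 - \<bar>r\<bar>)\<^sup>2 > 0" using assms by simp
  ultimately show ?thesis by (simp add: poisson_base_def power2_diff)
qed

lemma poisson_base_measurable[measurable]: "poisson_base r \<in> borel_measurable borel"
  unfolding poisson_base_def by measurable

lemma poisson_base_continuous:
  "continuous_on S (\<lambda>x. poisson_base (f x) (h x))" if "continuous_on S f" "continuous_on S h"
  unfolding poisson_base_def using that by (intro continuous_intros)

lemma poisson_base_split: "poisson_base r s = (1 - s\<^sup>2) + (s - r)\<^sup>2"
  by (simp add: poisson_base_def power2_eq_square algebra_simps)

lemma poisson_powr_bounded:
  assumes "\<bar>r\<bar> < 1"
  obtains B where "\<And>s. \<bar>s\<bar> \<le> 1 \<Longrightarrow> \<bar>poisson_base r s powr p\<bar> \<le> B"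
proof -
  have "continuous_on {-1..1} (\<lambda>s. poisson_base r s powr p)"
    using assms by (intro continuous_on_powr poisson_base_continuous continuous_intros)
      (auto dest!: poisson_base_pos[of r] simp: abs_le_iff)
  from continuous_on_unit_interval_bounded[OF this] show thesis using that by blast
qed

lemma poisson_powr_deriv_s:
  assumes "\<bar>r\<bar> < 1" "\<bar>s\<bar> \<le> 1"
  shows "((\<lambda>s. poisson_base r s powr p) has_real_derivative
    (- 2 * r * p) * poisson_base r s powr (p - 1)) (at s)"
proof -
  have "((\<lambda>s. poisson_base r s) has_real_derivative (- 2 * r)) (at s)"
    unfolding poisson_base_def by (auto intro!: derivative_eq_intros)
  from DERIV_powr[OF this poisson_base_pos[OF assms] DERIV_const[of p]]
  show ?thesis
    using poisson_base_pos[OF assms] by (simp add: powr_diff field_simps)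
qed

lemma poisson_powr_deriv_r:
  assumes "\<bar>r\<bar> < 1" "\<bar>s\<bar> \<le> 1"
  shows "((\<lambda>r. (s - r) * poisson_base r s powr p) has_real_derivative
    (- (poisson_base r s powr p) - 2 * p * (s - r)\<^sup>2 * poisson_base r s powr (p - 1))) (at r)"
proof -
  have "((\<lambda>r. poisson_base r s) has_real_derivative (2 * r - 2 * s)) (at r)"
    unfolding poisson_base_def by (auto intro!: derivative_eq_intros)
  from DERIV_powr[OF this poisson_base_pos[OF assms] DERIV_const[of p]]
  have "((\<lambda>r. poisson_base r s powr p) has_real_derivative
      (p * (2 * r - 2 * s)) * poisson_base r s powr (p - 1)) (at r)"
    using poisson_base_pos[OF assms] by (simp add: powr_diff field_simps)
  from DERIV_mult[OF DERIV_diff[OF DERIV_const[of s] DERIV_ident] this]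
  show ?thesis by (simp add: power2_eq_square algebra_simps)
qed

lemma powr_pred_mult: "x > 0 \<Longrightarrow> x * x powr (p - 1) = x powr p" for x :: real
  by (simp add: powr_diff)

context rotation_invariant_sphere
begin

lemma poisson_by_parts:
  assumes r: "\<bar>r\<bar> < 1" and e: "norm e = 1"
  shows "(- 2 * r * p) * (\<integral>u. poisson_base r (u \<bullet> e) powr (p - 1) * (1 - (u \<bullet> e)\<^sup>2) \<partial>\<sigma>)
    = (DIM('a) - 1) * (\<integral>u. poisson_base r (u \<bullet> e) powr p * (u \<bullet> e) \<partial>\<sigma>)"
proof -
  have "(\<integral>u. (- 2 * r * p) * poisson_base r (u \<bullet> e) powr (p - 1) * (1 - (u \<bullet> e)\<^sup>2) \<partial>\<sigma>)
    = (DIM('a) - 1) * (\<integral>u. poisson_base r (u \<bullet> e) powr p * (u \<bullet> e) \<partial>\<sigma>)"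
  proof (rule zonal_by_parts[OF _ _ poisson_powr_deriv_s[OF r] _ e])
    show "continuous_on {- 1..1} (\<lambda>s. - 2 * r * p * poisson_base r s powr (p - 1))"
      using r by (intro continuous_on_mult continuous_on_powr poisson_base_continuous continuous_intros)
        (auto dest!: poisson_base_pos[of r] simp: abs_le_iff)
  qed auto
  then show ?thesis by (simp only: mult.assoc Bochner_Integration.integral_mult_right_zero)
qed

text \<open>In the unknown \<open>r\<close> the integral \<open>F r\<close> below is, up to a factor, the flux through the sphere of
  radius \<open>r\<close> of the gradient of the fundamental solution of the Laplacian with pole on the unit sphere.
  Integration by parts gives \<open>r * F' r + (d - 1) * F r = 0\<close>, whose only solution regular at \<open>0\<close> is \<open>0\<close>.\<close>

lemma poisson_flux_zero:
  assumes r: "0 \<le> r" "r < 1" and e: "norm e = 1"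
  shows "(\<integral>u. ((u \<bullet> e) - r) * poisson_base r (u \<bullet> e) powr (- DIM('a) / 2) \<partial>\<sigma>) = 0"
proof -
  let ?d = "real DIM('a)"
  define p where "p = - ?d / 2"
  define F where "F r = (\<integral>u. ((u \<bullet> e) - r) * poisson_base r (u \<bullet> e) powr p \<partial>\<sigma>)" for r
  define F' where "F' r = (\<integral>u. - (poisson_base r (u \<bullet> e) powr p)
      - 2 * p * ((u \<bullet> e) - r)\<^sup>2 * poisson_base r (u \<bullet> e) powr (p - 1) \<partial>\<sigma>)" for r
  have ue: "\<bar>u \<bullet> e\<bar> \<le> 1" if "norm u = 1" for u using unit_inner_le[OF that, of e] e by simp
  have int: "integrable \<sigma> (\<lambda>u. poisson_base r (u \<bullet> e) powr q)"
    "integrable \<sigma> (\<lambda>u. poisson_base r (u \<bullet> e) powr q * (u \<bullet> e))"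
    "integrable \<sigma> (\<lambda>u. poisson_base r (u \<bullet> e) powr q * ((u \<bullet> e) * (u \<bullet> e)))" if r1: "\<bar>r\<bar> < 1" for r q
  proof -
    obtain B where B: "\<And>s. \<bar>s\<bar> \<le> 1 \<Longrightarrow> \<bar>poisson_base r s powr q\<bar> \<le> B"
      using poisson_powr_bounded[OF r1] by blast
    have m: "(\<lambda>s. poisson_base r s powr q) \<in> borel_measurable borel" by measurable
    show "integrable \<sigma> (\<lambda>u. poisson_base r (u \<bullet> e) powr q)"
      "integrable \<sigma> (\<lambda>u. poisson_base r (u \<bullet> e) powr q * (u \<bullet> e))"
      "integrable \<sigma> (\<lambda>u. poisson_base r (u \<bullet> e) powr q * ((u \<bullet> e) * (u \<bullet> e)))"
      using zonal_integrable[OF m B e] by blast+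
  qed
  have F: "(F has_real_derivative F' r) (at r)" if r: "\<bar>r\<bar> < 1" for r
  proof -
    define \<delta> where "\<delta> = (1 - \<bar>r\<bar>) / 2"
    have \<delta>: "\<bar>y\<bar> < 1" if "\<bar>y - r\<bar> \<le> \<delta>" for y
      using r that abs_triangle_ineq[of "y - r" r] by (simp add: \<delta>_def)
    have \<delta>0: "\<delta> > 0" using r by (simp add: \<delta>_def)
    let ?f' = "\<lambda>y s. - (poisson_base y s powr p) - 2 * p * (s - y)\<^sup>2 * poisson_base y s powr (p - 1)"
    have nz: "poisson_base y s \<noteq> 0" if "y \<in> {r - \<delta>..r + \<delta>}" "s \<in> {-1..1}" for y s
      using poisson_base_pos[of y s] \<delta>[of y] that by (fastforce simp: abs_le_iff)
    have "continuous_on ({r - \<delta>..r + \<delta>} \<times> {-1..1}) (\<lambda>x. ?f' (fst x) (snd x))"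
      by (intro continuous_on_diff continuous_on_minus continuous_on_mult continuous_on_powr
          poisson_base_continuous continuous_on_power continuous_on_const continuous_on_fst continuous_on_snd continuous_on_id)
        (auto dest: nz[rotated -1])
    from compact_imp_bounded[OF compact_continuous_image[OF this compact_Times[OF compact_Icc compact_Icc]]]
    obtain B where B: "\<And>y s. \<bar>y - r\<bar> \<le> \<delta> \<Longrightarrow> \<bar>s\<bar> \<le> 1 \<Longrightarrow> \<bar>?f' y s\<bar> \<le> B"
    proof -
      assume "bounded ((\<lambda>x. ?f' (fst x) (snd x)) ` ({r - \<delta>..r + \<delta>} \<times> {-1..1}))"
      then obtain B where B: "\<And>x. x \<in> {r - \<delta>..r + \<delta>} \<times> {-1..1} \<Longrightarrow> norm (?f' (fst x) (snd x)) \<le> B"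
        unfolding bounded_iff by blast
      have "\<bar>?f' y s\<bar> \<le> B" if "\<bar>y - r\<bar> \<le> \<delta>" "\<bar>s\<bar> \<le> 1" for y s
        using B[of "(y, s)"] that by (simp add: abs_le_iff)
      then show thesis by (rule that)
    qed
    show ?thesis
      unfolding F_def[abs_def] F'_def
    proof (rule has_real_derivative_integral[where \<delta> = \<delta> and B = B and f' = "\<lambda>y u. ?f' y (u \<bullet> e)"])
      show "finite_measure \<sigma>" by (rule finite_measure_axioms)
      show "AE u in \<sigma>. \<forall>y. \<bar>y - r\<bar> < \<delta> \<longrightarrow>
         ((\<lambda>y. ((u \<bullet> e) - y) * poisson_base y (u \<bullet> e) powr p) has_real_derivative ?f' y (u \<bullet> e)) (at y)
         \<and> \<bar>?f' y (u \<bullet> e)\<bar> \<le> B"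
        using AE_norm
        by eventually_elim (intro allI impI conjI poisson_powr_deriv_r B \<delta> ue; simp)
      show "integrable \<sigma> (\<lambda>u. ((u \<bullet> e) - y) * poisson_base y (u \<bullet> e) powr p)" if "\<bar>y - r\<bar> < \<delta>" for y
        using int(1,2)[OF \<delta>[of y], of p] that by (simp add: left_diff_distrib mult.commute)
      show "(\<lambda>u. ?f' r (u \<bullet> e)) \<in> borel_measurable \<sigma>"
        by (rule measurable_sphere) measurable
    qed (rule \<delta>0)
  qed
  have ode: "r * F' r + (?d - 1) * F r = 0" if r: "\<bar>r\<bar> < 1" for r
  proof -
    note i = int[OF r]
    let ?K = "\<lambda>q u. poisson_base r (u \<bullet> e) powr q"
    define J where "J = (\<integral>u. ?K p u \<partial>\<sigma>)"
    define L where "L = (\<integral>u. ?K (p - 1) u * (1 - (u \<bullet> e)\<^sup>2) \<partial>\<sigma>)"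
    have "F' r = (\<integral>u. (?d - 1) * ?K p u - ?d * (?K (p - 1) u * (1 - (u \<bullet> e)\<^sup>2)) \<partial>\<sigma>)"
      unfolding F'_def
    proof (rule integral_cong_sphere)
      fix u :: 'a assume "norm u = 1"
      have sq: "((u \<bullet> e) - r)\<^sup>2 = poisson_base r (u \<bullet> e) - (1 - (u \<bullet> e)\<^sup>2)"
        using poisson_base_split[of r "u \<bullet> e"] by simp
      have "?K p u = poisson_base r (u \<bullet> e) * ?K (p - 1) u"
        using poisson_base_pos[OF r ue[OF \<open>norm u = 1\<close>]] by (simp add: powr_pred_mult)
      then show "- ?K p u - 2 * p * ((u \<bullet> e) - r)\<^sup>2 * ?K (p - 1) u
          = (?d - 1) * ?K p u - ?d * (?K (p - 1) u * (1 - (u \<bullet> e)\<^sup>2))"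
        unfolding sq by (simp add: p_def algebra_simps)
    qed measurable
    also have "\<dots> = (?d - 1) * (\<integral>u. ?K p u \<partial>\<sigma>) - ?d * (\<integral>u. ?K (p - 1) u * (1 - (u \<bullet> e)\<^sup>2) \<partial>\<sigma>)"
      using i by (simp add: right_diff_distrib power2_eq_square)
    finally have F'r: "F' r = (?d - 1) * J - ?d * L" unfolding J_def L_def .
    have "- 2 * r * p = r * ?d" by (simp add: p_def)
    then have "r * F' r = (?d - 1) * (r * J) - (- 2 * r * p) * L"
      unfolding F'r by (simp add: algebra_simps)
    also have "\<dots> = (?d - 1) * (r * J) - (?d - 1) * (\<integral>u. ?K p u * (u \<bullet> e) \<partial>\<sigma>)"
      unfolding L_def poisson_by_parts[OF r e] using dim by (simp add: of_nat_diff)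
    finally have 1: "r * F' r = (?d - 1) * (r * J) - (?d - 1) * (\<integral>u. ?K p u * (u \<bullet> e) \<partial>\<sigma>)" .
    have "((u \<bullet> e) - r) * ?K p u = ?K p u * (u \<bullet> e) - r * ?K p u" for u
      by (simp add: algebra_simps)
    then have 2: "F r = (\<integral>u. ?K p u * (u \<bullet> e) \<partial>\<sigma>) - r * J"
      unfolding F_def J_def using i by simp
    show ?thesis unfolding 1 2 by (simp add: algebra_simps)
  qed
  define n where "n = DIM('a) - 2"
  have n: "DIM('a) = n + 2" using dim by (simp add: n_def)
  define H where "H r = r ^ (n + 1) * F r" for r
  have H: "(H has_real_derivative 0) (at r)" if r: "\<bar>r\<bar> < 1" for r
  proof -
    have "(H has_real_derivative (real (n + 1) * r ^ n) * F r + F' r * r ^ (n + 1)) (at r)"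
      unfolding H_def[abs_def] using DERIV_mult[OF DERIV_pow[of "n + 1"] F[OF r]] by simp
    moreover have "(real (n + 1) * r ^ n) * F r + F' r * r ^ (n + 1) = r ^ n * (r * F' r + (?d - 1) * F r)"
      by (simp add: n algebra_simps)
    ultimately show ?thesis using ode[OF r] by simp
  qed
  have "F r = 0"
  proof (cases "r = 0")
    case True
    then show ?thesis using ode[of 0] dim by simp
  next
    case False
    have "H r = H 0"
    proof (rule DERIV_isconst2[of 0 r])
      show "continuous_on {0..r} H"
        using r by (intro DERIV_continuous_on[where D = "\<lambda>_. 0"] has_field_derivative_at_within[OF H]) simp
    qed (use r H False in auto)
    then show ?thesis using False by (simp add: H_def)
  qed
  then show ?thesis by (simp add: F_def p_def)
qed

lemma poisson_moments:
  assumes r: "0 \<le> r" "r < 1" and e: "norm e = 1"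
  defines "P \<equiv> \<lambda>s. poisson_base r s powr (- DIM('a) / 2)"
  defines "m \<equiv> \<integral>u. P (u \<bullet> e) \<partial>\<sigma>"
  shows "(\<integral>u. P (u \<bullet> e) * (u \<bullet> y) \<partial>\<sigma>) = r * (y \<bullet> e) * m"
    and "(\<integral>u. P (u \<bullet> e) * ((u \<bullet> y) * (u \<bullet> z)) \<partial>\<sigma>)
      = (r\<^sup>2 * (y \<bullet> e) * (z \<bullet> e) + (1 - r\<^sup>2) / DIM('a) * (y \<bullet> z)) * m"
proof -
  let ?d = "real DIM('a)"
  have d: "?d \<ge> 2" using dim by simp
  have r': "\<bar>r\<bar> < 1" using r by simp
  obtain B where B: "\<And>s. \<bar>s\<bar> \<le> 1 \<Longrightarrow> \<bar>P s\<bar> \<le> B"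
    unfolding P_def using poisson_powr_bounded[OF r'] by blast
  have P: "P \<in> borel_measurable borel" unfolding P_def by measurable
  note int = zonal_integrable[OF P B e]
  let ?M1 = "\<integral>u. P (u \<bullet> e) * (u \<bullet> e) \<partial>\<sigma>" and ?M2 = "\<integral>u. P (u \<bullet> e) * ((u \<bullet> e) * (u \<bullet> e)) \<partial>\<sigma>"
  have "((u \<bullet> e) - r) * P (u \<bullet> e) = P (u \<bullet> e) * (u \<bullet> e) - r * P (u \<bullet> e)" for u
    by (simp add: algebra_simps)
  then have "(\<integral>u. ((u \<bullet> e) - r) * P (u \<bullet> e) \<partial>\<sigma>) = ?M1 - r * m"
    using int by (simp add: m_def)
  then have M1: "?M1 = r * m"
    using poisson_flux_zero[OF r e] by (simp add: P_def)
  show "(\<integral>u. P (u \<bullet> e) * (u \<bullet> y) \<partial>\<sigma>) = r * (y \<bullet> e) * m"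
    using zonal_first[OF P B e, of y] by (simp add: M1)
  have M2: "?M2 = (r\<^sup>2 + (1 - r\<^sup>2) / ?d) * m"
  proof (cases "r = 0")
    case True
    have e1: "e \<bullet> e = 1" using e by (simp add: dot_square_norm)
    have "P s = 1" for s using True by (simp add: P_def poisson_base_def)
    then show ?thesis using True second_moment[of e e] by (simp add: m_def e1)
  next
    case False
    have "(- 2 * r * (1 - ?d / 2)) * (\<integral>u. P (u \<bullet> e) * (1 - (u \<bullet> e)\<^sup>2) \<partial>\<sigma>)
        = (?d - 1) * (\<integral>u. poisson_base r (u \<bullet> e) powr (1 - ?d / 2) * (u \<bullet> e) \<partial>\<sigma>)"
      using poisson_by_parts[OF r' e, of "1 - ?d / 2"] dim by (simp add: P_def of_nat_diff)
    also have "(\<integral>u. poisson_base r (u \<bullet> e) powr (1 - ?d / 2) * (u \<bullet> e) \<partial>\<sigma>)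
        = (\<integral>u. (1 + r\<^sup>2) * (P (u \<bullet> e) * (u \<bullet> e)) - 2 * r * (P (u \<bullet> e) * ((u \<bullet> e) * (u \<bullet> e))) \<partial>\<sigma>)"
    proof (rule integral_cong_sphere)
      fix u :: 'a assume u: "norm u = 1"
      then have "\<bar>u \<bullet> e\<bar> \<le> 1" using unit_inner_le[OF u, of e] e by simp
      from powr_pred_mult[OF poisson_base_pos[OF r' this], of "1 - ?d / 2"]
      have "poisson_base r (u \<bullet> e) powr (1 - ?d / 2) = poisson_base r (u \<bullet> e) * P (u \<bullet> e)"
        by (simp add: P_def)
      then show "poisson_base r (u \<bullet> e) powr (1 - ?d / 2) * (u \<bullet> e)
          = (1 + r\<^sup>2) * (P (u \<bullet> e) * (u \<bullet> e)) - 2 * r * (P (u \<bullet> e) * ((u \<bullet> e) * (u \<bullet> e)))"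
        by (simp only:) (simp add: poisson_base_def algebra_simps)
    qed (use P in measurable)
    also have "\<dots> = (1 + r\<^sup>2) * (r * m) - 2 * r * ?M2"
      using int by (simp add: M1)
    also have "(\<integral>u. P (u \<bullet> e) * (1 - (u \<bullet> e)\<^sup>2) \<partial>\<sigma>) = m - ?M2"
      using int by (simp add: right_diff_distrib power2_eq_square m_def)
    finally have "r * (?d * ?M2) = r * ((?d * r\<^sup>2 + (1 - r\<^sup>2)) * m)"
      by (simp add: algebra_simps power2_eq_square)
    then have "?d * ?M2 = (?d * r\<^sup>2 + (1 - r\<^sup>2)) * m" using False by simp
    then show ?thesis using d by (simp add: field_simps)
  qed
  have C: "(m - ?M2) / (?d - 1) = (1 - r\<^sup>2) / ?d * m"
    unfolding M2 using d by (simp add: field_simps)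
  have D: "real (DIM('a) - 1) = ?d - 1" using dim by (simp add: of_nat_diff)
  define k where "k = (1 - r\<^sup>2) / ?d"
  have "(\<integral>u. P (u \<bullet> e) * ((u \<bullet> y) * (u \<bullet> z)) \<partial>\<sigma>)
      = (y \<bullet> e) * (z \<bullet> e) * ?M2 + (y \<bullet> z - (y \<bullet> e) * (z \<bullet> e)) * ((m - ?M2) / (?d - 1))"
    using zonal_second[OF P B e, of y z] unfolding m_def D .
  then show "(\<integral>u. P (u \<bullet> e) * ((u \<bullet> y) * (u \<bullet> z)) \<partial>\<sigma>)
      = (r\<^sup>2 * (y \<bullet> e) * (z \<bullet> e) + (1 - r\<^sup>2) / DIM('a) * (y \<bullet> z)) * m"
    unfolding C unfolding M2 k_def[symmetric] by (simp add: algebra_simps)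
qed

end

section \<open>Moments of the spherical pair\<close>

lemma rotation_invariant_sphere_surface:
  assumes "CARD('d) \<ge> 2"
  shows "rotation_invariant_sphere (sphere_surface :: (real^'d) measure)"
proof -
  let ?w = "\<lambda>x::real^'d. ennreal (real CARD('d)) * indicator (ball 0 1) x"
  let ?D = "density lborel ?w"
  have w: "?w \<in> borel_measurable borel"
    by (intro borel_measurable_times_ennreal borel_measurable_indicator) auto
  have sgn: "sgn \<in> borel_measurable ?D" by simp
  have eq: "sphere_surface = distr ?D borel (sgn :: real^'d \<Rightarrow> _)"
    by (simp add: sphere_surface_def)
  have "emeasure ?D (space ?D) = ennreal (real CARD('d)) * emeasure lborel (ball 0 1 :: (real^'d) set)"
    using w by (simp add: emeasure_density nn_integral_cmult borel_measurable_indicator)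
  also have "\<dots> < \<infinity>" by (simp add: emeasure_ball ennreal_mult_less_top)
  finally have fin: "finite_measure ?D" by (intro finite_measureI) auto
  have "AE x in ?D. x \<noteq> 0"
    using AE_lborel_singleton[of "0 :: real^'d"] w by (subst AE_density) (auto elim: eventually_mono)
  then have AE: "AE x in ?D. norm (sgn x) = 1" by eventually_elim (simp add: norm_sgn)
  show ?thesis
  proof (intro rotation_invariant_sphere.intro rotation_invariant_sphere_axioms.intro)
    show "finite_measure (sphere_surface :: (real^'d) measure)"
      unfolding eq by (rule finite_measure.finite_measure_distr[OF fin sgn])
    show "sets sphere_surface = sets (borel :: (real^'d) measure)" by (simp add: eq)
    show "AE x in sphere_surface. norm (x :: real^'d) = 1"
      unfolding eq using AE by (subst AE_distr_iff) auto
    show "2 \<le> DIM(real^'d)" using assms by simp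
    fix T :: "real^'d \<Rightarrow> real^'d" assume T: "orthogonal_transformation T"
    have Tm[measurable]: "T \<in> borel_measurable borel"
      using orthogonal_transformation_linear[OF T]
      by (intro borel_measurable_continuous_onI linear_continuous_on) (simp add: linear_conv_bounded_linear)
    have wT: "?w (T x) = ?w x" for x
      by (simp add: indicator_def orthogonal_transformation_norm[OF T])
    have "T (sgn x) = sgn (T x)" for x
      using orthogonal_transformation_scaleR[OF T] orthogonal_transformation_norm[OF T]
      by (simp add: sgn_div_norm)
    then have "distr sphere_surface borel T = distr ?D borel (\<lambda>x. sgn (T x))"
      unfolding eq by (subst distr_distr) (auto simp: comp_def)
    also have "\<dots> = distr (distr (density lborel (\<lambda>x. ?w (T x))) borel T) borel sgn"
      unfolding wT by (subst distr_distr) (auto simp: comp_def)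
    also have "distr (density lborel (\<lambda>x. ?w (T x))) borel T = density (distr lborel borel T) ?w"
      using w by (intro density_distr[symmetric]) auto
    also have "\<dots> = ?D" by (simp add: distr_lborel_orthogonal[OF T])
    finally show "distr sphere_surface borel T = sphere_surface" by (simp add: eq)
  qed
qed

lemma cdens_eq_poisson:
  "cdens \<rho> Q u v = (1 - \<rho>\<^sup>2) / (sphere_area CARD('d))\<^sup>2
     * poisson_base \<rho> (u \<bullet> (Q *v v)) powr (- DIM(real^'d) / 2)" for u v :: "real^'d"
  by (simp add: cdens_def poisson_base_def powr_minus_divide)

locale spherical_pair = prob_space M for M :: "'s measure" +
  fixes \<rho> :: real and Q :: "real^'d^'d" and X Y :: "'s \<Rightarrow> real^'d"
  assumes dim2: "CARD('d) \<ge> 2" and \<rho>: "0 \<le> \<rho>" "\<rho> < 1" and Q: "orthogonal_matrix Q"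
    and dist: "distributed M (sphere_surface \<Otimes>\<^sub>M sphere_surface) (\<lambda>\<omega>. (X \<omega>, Y \<omega>))
      (\<lambda>(u, v). ennreal (cdens \<rho> Q u v))"
begin

abbreviation \<sigma> :: "(real^'d) measure" where "\<sigma> \<equiv> sphere_surface"

sublocale S: rotation_invariant_sphere \<sigma>
  by (rule rotation_invariant_sphere_surface[OF dim2])

sublocale SS: pair_sigma_finite \<sigma> \<sigma> ..

lemma sets_pair: "sets (\<sigma> \<Otimes>\<^sub>M \<sigma>) = sets (borel \<Otimes>\<^sub>M borel)"
  by (rule sets_pair_measure_cong[OF S.sets_sphere S.sets_sphere])

lemma measurable_pair: "f \<in> borel_measurable (borel \<Otimes>\<^sub>M borel) \<Longrightarrow> f \<in> borel_measurable (\<sigma> \<Otimes>\<^sub>M \<sigma>)"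
  by (simp add: measurable_cong_sets[OF sets_pair refl])

lemma XY_measurable[measurable]: "X \<in> borel_measurable M" "Y \<in> borel_measurable M"
proof -
  have XY: "(\<lambda>\<omega>. (X \<omega>, Y \<omega>)) \<in> M \<rightarrow>\<^sub>M borel \<Otimes>\<^sub>M borel"
    using distributed_measurable[OF dist] by (simp add: measurable_cong_sets[OF refl sets_pair])
  from measurable_compose[OF this measurable_fst] measurable_compose[OF this measurable_snd]
  show "X \<in> borel_measurable M" "Y \<in> borel_measurable M" by simp_all
qed

lemma AE_pair_norm: "AE x in \<sigma> \<Otimes>\<^sub>M \<sigma>. norm (fst x) = 1 \<and> norm (snd x) = 1"
proof (rule SS.AE_pair_measure)
  have "(\<lambda>x::(real^'d) \<times> (real^'d). norm (fst x) = 1 \<and> norm (snd x) = 1)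
      \<in> measurable (borel \<Otimes>\<^sub>M borel) (count_space UNIV)" by measurable
  then have "{x \<in> space (borel \<Otimes>\<^sub>M borel). norm (fst x :: real^'d) = 1 \<and> norm (snd x :: real^'d) = 1}
      \<in> sets (borel \<Otimes>\<^sub>M borel)" by measurable
  then show "{x \<in> space (\<sigma> \<Otimes>\<^sub>M \<sigma>). norm (fst x) = 1 \<and> norm (snd x) = 1} \<in> sets (\<sigma> \<Otimes>\<^sub>M \<sigma>)"
    by (simp add: sets_pair sets_eq_imp_space_eq[OF sets_pair])
  show "AE x in \<sigma>. AE y in \<sigma>. norm (fst (x, y)) = 1 \<and> norm (snd (x, y)) = 1"
    using S.AE_norm by eventually_elim (use S.AE_norm in auto)
qed

lemma AE_XY_norm: "AE \<omega> in M. norm (X \<omega>) = 1 \<and> norm (Y \<omega>) = 1"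
proof -
  have f: "(\<lambda>(u, v). ennreal (cdens \<rho> Q u v)) \<in> borel_measurable (\<sigma> \<Otimes>\<^sub>M \<sigma>)"
    by (rule distributed_borel_measurable[OF dist])
  have "AE x in distr M (\<sigma> \<Otimes>\<^sub>M \<sigma>) (\<lambda>\<omega>. (X \<omega>, Y \<omega>)). norm (fst x) = 1 \<and> norm (snd x) = 1"
    unfolding distributed_distr_eq_density[OF dist] AE_density[OF f]
    using AE_pair_norm by eventually_elim simp
  from AE_distrD[OF distributed_measurable[OF dist] this] show ?thesis by simp
qed

lemma integrable_XY:
  fixes h :: "real^'d \<Rightarrow> real^'d \<Rightarrow> 'b::{banach, second_countable_topology}"
  assumes "(\<lambda>\<omega>. h (X \<omega>) (Y \<omega>)) \<in> borel_measurable M"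
    and "\<And>u v. norm u = 1 \<Longrightarrow> norm v = 1 \<Longrightarrow> norm (h u v) \<le> B"
  shows "integrable M (\<lambda>\<omega>. h (X \<omega>) (Y \<omega>))"
  using AE_XY_norm assms by (intro integrable_const_bound[of _ B]) auto

lemma integrable_monomials:
  "integrable M (\<lambda>\<omega>. (X \<omega> \<bullet> y) * (Y \<omega> \<bullet> z))"
  "integrable M (\<lambda>\<omega>. ((X \<omega> \<bullet> y) * (X \<omega> \<bullet> y')) * ((Y \<omega> \<bullet> z) * (Y \<omega> \<bullet> z')))"
proof -
  show "integrable M (\<lambda>\<omega>. (X \<omega> \<bullet> y) * (Y \<omega> \<bullet> z))"
    by (rule integrable_XY[of "\<lambda>u v. (u \<bullet> y) * (v \<bullet> z)" "norm y * norm z"])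
      (auto simp: abs_mult intro!: mult_mono S.unit_inner_le)
  show "integrable M (\<lambda>\<omega>. ((X \<omega> \<bullet> y) * (X \<omega> \<bullet> y')) * ((Y \<omega> \<bullet> z) * (Y \<omega> \<bullet> z')))"
    by (rule integrable_XY[of "\<lambda>u v. ((u \<bullet> y) * (u \<bullet> y')) * ((v \<bullet> z) * (v \<bullet> z'))" "(norm y * norm y') * (norm z * norm z')"])
      (auto simp: abs_mult intro!: mult_mono S.unit_inner_le)
qed

definition kernel :: "real^'d \<Rightarrow> real^'d \<Rightarrow> real" where
  "kernel u v = poisson_base \<rho> (u \<bullet> (Q *v v)) powr (- DIM(real^'d) / 2)"

lemma norm_Q: "norm v = 1 \<Longrightarrow> norm (Q *v v) = 1"
  using Q orthogonal_transformation_norm[of "(*v) Q" v] by (simp add: orthogonal_transformation_matrix)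

lemma inner_Q: "u \<bullet> (Q *v v) = (u v* Q) \<bullet> v"
  by (rule dot_lmul_matrix[symmetric])

lemma inner_Q_Q: "(u v* Q) \<bullet> (w v* Q) = u \<bullet> w"
proof -
  have "Q *v (w v* Q) = w"
    using Q by (simp add: orthogonal_matrix_def matrix_vector_mul_assoc flip: transpose_matrix_vector)
  then show ?thesis by (simp add: dot_lmul_matrix)
qed

lemma expectation_XY:
  assumes hm: "(\<lambda>x. h (fst x) (snd x)) \<in> borel_measurable (borel \<Otimes>\<^sub>M borel)"
    and h: "\<And>u v. norm u = 1 \<Longrightarrow> norm v = 1 \<Longrightarrow> \<bar>h u v\<bar> \<le> B"
    and Hm: "H \<in> borel_measurable borel"
    and H: "\<And>v. norm v = 1 \<Longrightarrow> (\<integral>u. kernel u v * h u v \<partial>\<sigma>) = H v"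
  shows "expectation (\<lambda>\<omega>. h (X \<omega>) (Y \<omega>))
    = (1 - \<rho>\<^sup>2) / (sphere_area CARD('d))\<^sup>2 * (\<integral>v. H v \<partial>\<sigma>)"
proof -
  let ?c = "(1 - \<rho>\<^sup>2) / (sphere_area CARD('d))\<^sup>2"
  have Qm: "(\<lambda>v. Q *v v) \<in> borel_measurable borel"
    by (intro borel_measurable_continuous_onI continuous_intros)
  have km: "(\<lambda>x. kernel (fst x) (snd x)) \<in> borel_measurable (borel \<Otimes>\<^sub>M borel)"
    unfolding kernel_def using measurable_compose[OF measurable_snd Qm] by measurable
  have "\<bar>\<rho>\<bar> < 1" using \<rho> by simp
  from poisson_powr_bounded[OF this, of "- DIM(real^'d) / 2"] obtain K where
    K: "\<And>s. \<bar>s\<bar> \<le> 1 \<Longrightarrow> \<bar>poisson_base \<rho> s powr (- DIM(real^'d) / 2)\<bar> \<le> K" by blast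
  have kB: "\<bar>kernel u v\<bar> \<le> K" if "norm u = 1" "norm v = 1" for u v
    unfolding kernel_def using S.unit_inner_le[OF that(1), of "Q *v v"] norm_Q[OF that(2)] by (intro K) simp
  interpret P: finite_measure "\<sigma> \<Otimes>\<^sub>M \<sigma>"
    by (intro finite_measure_pair_measure S.finite_measure_axioms)
  have int: "integrable (\<sigma> \<Otimes>\<^sub>M \<sigma>) (\<lambda>x. kernel (fst x) (snd x) * h (fst x) (snd x))"
  proof (rule P.integrable_const_bound[of _ "K * B"])
    show "AE x in \<sigma> \<Otimes>\<^sub>M \<sigma>. norm (kernel (fst x) (snd x) * h (fst x) (snd x)) \<le> K * B"
      using AE_pair_norm
    proof eventually_elim
      case (elim x)
      then have "\<bar>kernel (fst x) (snd x)\<bar> \<le> K" "\<bar>h (fst x) (snd x)\<bar> \<le> B" using kB h by auto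
      then show ?case unfolding real_norm_def abs_mult by (intro mult_mono) auto
    qed
    show "(\<lambda>x. kernel (fst x) (snd x) * h (fst x) (snd x)) \<in> borel_measurable (\<sigma> \<Otimes>\<^sub>M \<sigma>)"
      by (intro borel_measurable_times measurable_pair km hm)
  qed
  let ?f = "\<lambda>x. cdens \<rho> Q (fst x) (snd x)"
  have fk: "?f x = ?c * kernel (fst x) (snd x)" for x
    by (simp only: cdens_eq_poisson kernel_def)
  have "1 - \<rho>\<^sup>2 \<ge> 0" using \<rho> by (simp add: power_le_one)
  then have f0: "0 \<le> ?f x" for x unfolding fk by (simp add: kernel_def)
  have "distributed M (\<sigma> \<Otimes>\<^sub>M \<sigma>) (\<lambda>\<omega>. (X \<omega>, Y \<omega>)) (\<lambda>x. ennreal (?f x))"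
    using dist by (simp add: case_prod_beta')
  from distributed_integral[OF this measurable_pair[OF hm] f0]
  have "expectation (\<lambda>\<omega>. h (X \<omega>) (Y \<omega>)) = (\<integral>x. ?c * (kernel (fst x) (snd x) * h (fst x) (snd x)) \<partial>(\<sigma> \<Otimes>\<^sub>M \<sigma>))"
    by (simp only: fk fst_conv snd_conv mult.assoc)
  also have "\<dots> = ?c * (\<integral>x. kernel (fst x) (snd x) * h (fst x) (snd x) \<partial>(\<sigma> \<Otimes>\<^sub>M \<sigma>))"
    by (rule Bochner_Integration.integral_mult_right_zero)
  also have "(\<integral>x. kernel (fst x) (snd x) * h (fst x) (snd x) \<partial>(\<sigma> \<Otimes>\<^sub>M \<sigma>))
      = (\<integral>v. (\<integral>u. kernel u v * h u v \<partial>\<sigma>) \<partial>\<sigma>)"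
    using SS.integral_snd[of "\<lambda>u v. kernel u v * h u v"] int by (simp add: case_prod_beta')
  also have "\<dots> = (\<integral>v. H v \<partial>\<sigma>)"
  proof (rule integral_cong_AE)
    show "(\<lambda>v. \<integral>u. kernel u v * h u v \<partial>\<sigma>) \<in> borel_measurable \<sigma>"
      using SS.integrable_snd[of "\<lambda>u v. kernel u v * h u v"] int by (simp add: case_prod_beta')
    show "AE v in \<sigma>. (\<integral>u. kernel u v * h u v \<partial>\<sigma>) = H v"
      using S.AE_norm by eventually_elim (rule H)
  qed (rule S.measurable_sphere[OF Hm])
  finally show ?thesis .
qed

text \<open>By invariance the mass \<open>\<integral>u. kernel u v \<partial>\<sigma>\<close> does not depend on \<open>v\<close>. Its value is never computed:
  it cancels because the density integrates to one.\<close>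

definition mass :: real where
  "mass = (\<integral>u. poisson_base \<rho> (u \<bullet> axis undefined 1) powr (- DIM(real^'d) / 2) \<partial>\<sigma>)"

lemma mass_eq:
  assumes "norm e = 1"
  shows "(\<integral>u. poisson_base \<rho> (u \<bullet> e) powr (- DIM(real^'d) / 2) \<partial>\<sigma>) = mass"
  unfolding mass_def
  by (rule S.integral_swap[of _ _ 0 "\<lambda>_ b. poisson_base \<rho> b powr (- DIM(real^'d) / 2)"])
    (auto simp: assms norm_axis_1)

lemma kernel_moments:
  assumes "norm v = 1"
  shows "(\<integral>u. kernel u v \<partial>\<sigma>) = mass"
    and "(\<integral>u. kernel u v * (u \<bullet> y) \<partial>\<sigma>) = mass * (\<rho> * ((y v* Q) \<bullet> v))"
    and "(\<integral>u. kernel u v * ((u \<bullet> y) * (u \<bullet> y')) \<partial>\<sigma>)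
      = mass * (\<rho>\<^sup>2 * (((y v* Q) \<bullet> v) * ((y' v* Q) \<bullet> v)) + (1 - \<rho>\<^sup>2) / CARD('d) * (y \<bullet> y'))"
  using mass_eq[OF norm_Q[OF assms]] S.poisson_moments[OF \<rho> norm_Q[OF assms]]
  by (simp_all add: kernel_def inner_Q mult_ac)

lemma normalisation: "(1 - \<rho>\<^sup>2) / (sphere_area CARD('d))\<^sup>2 * (mass * S.total) = 1"
proof -
  have "expectation (\<lambda>_. 1 :: real) = (1 - \<rho>\<^sup>2) / (sphere_area CARD('d))\<^sup>2 * (\<integral>v. mass \<partial>\<sigma>)"
    by (rule expectation_XY[of "\<lambda>_ _. 1" 1 "\<lambda>_. mass"]) (simp_all add: kernel_moments(1))
  moreover have "(\<integral>v. mass \<partial>\<sigma>) = mass * S.total" "expectation (\<lambda>_. 1 :: real) = 1"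
    by (simp_all add: prob_space)
  ultimately show ?thesis by (simp only:)
qed

lemma first_moment:
  "expectation (\<lambda>\<omega>. (X \<omega> \<bullet> y) * (Y \<omega> \<bullet> z)) = \<rho> / CARD('d) * (y \<bullet> (Q *v z))"
proof -
  let ?c = "(1 - \<rho>\<^sup>2) / (sphere_area CARD('d))\<^sup>2" and ?q = "y v* Q"
  have "expectation (\<lambda>\<omega>. (X \<omega> \<bullet> y) * (Y \<omega> \<bullet> z)) = ?c * (\<integral>v. (mass * \<rho>) * ((v \<bullet> ?q) * (v \<bullet> z)) \<partial>\<sigma>)"
  proof (rule expectation_XY[of "\<lambda>u v. (u \<bullet> y) * (v \<bullet> z)" "norm y * norm z"])
    show "\<bar>(u \<bullet> y) * (v \<bullet> z)\<bar> \<le> norm y * norm z" if "norm u = 1" "norm v = 1" for u v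
      unfolding abs_mult using that by (intro mult_mono S.unit_inner_le) auto
    show "(\<integral>u. kernel u v * ((u \<bullet> y) * (v \<bullet> z)) \<partial>\<sigma>) = (mass * \<rho>) * ((v \<bullet> ?q) * (v \<bullet> z))"
      if "norm v = 1" for v
    proof -
      have "(\<integral>u. kernel u v * ((u \<bullet> y) * (v \<bullet> z)) \<partial>\<sigma>) = (\<integral>u. (kernel u v * (u \<bullet> y)) * (v \<bullet> z) \<partial>\<sigma>)"
        by (simp only: mult.assoc)
      also have "\<dots> = (\<integral>u. kernel u v * (u \<bullet> y) \<partial>\<sigma>) * (v \<bullet> z)"
        by (rule Bochner_Integration.integral_mult_left_zero)
      finally show ?thesis unfolding kernel_moments(2)[OF that] by (simp add: inner_commute[of v] mult_ac)
    qed
  qed measurable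
  also have "\<dots> = (?c * (mass * S.total)) * (\<rho> / CARD('d) * (?q \<bullet> z))"
    by (simp add: S.second_moment)
  finally show ?thesis unfolding normalisation by (simp add: inner_Q)
qed

lemma second_moment:
  "expectation (\<lambda>\<omega>. ((X \<omega> \<bullet> y) * (X \<omega> \<bullet> y')) * ((Y \<omega> \<bullet> z) * (Y \<omega> \<bullet> z')))
    = \<rho>\<^sup>2 / (real CARD('d) * (real CARD('d) + 2))
        * ((y \<bullet> y') * (z \<bullet> z') + (y \<bullet> (Q *v z)) * (y' \<bullet> (Q *v z')) + (y \<bullet> (Q *v z')) * (y' \<bullet> (Q *v z)))
      + (1 - \<rho>\<^sup>2) / (real CARD('d))\<^sup>2 * ((y \<bullet> y') * (z \<bullet> z'))"
proof -
  let ?c = "(1 - \<rho>\<^sup>2) / (sphere_area CARD('d))\<^sup>2" and ?q = "y v* Q" and ?q' = "y' v* Q"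
  let ?d = "real CARD('d)"
  define a where "a = (1 - \<rho>\<^sup>2) / ?d * (y \<bullet> y')"
  have factor: "c * (m * (r * (A * (t / D)) + b * (g * t / d))) = (c * (m * t)) * (r * (A / D) + b * (g / d))"
    for c m r A t D b g d :: real by (simp add: algebra_simps)
  let ?F = "\<lambda>v. (v \<bullet> ?q) * (v \<bullet> ?q') * ((v \<bullet> z) * (v \<bullet> z'))" and ?G = "\<lambda>v. (v \<bullet> z) * (v \<bullet> z')"
  have "expectation (\<lambda>\<omega>. ((X \<omega> \<bullet> y) * (X \<omega> \<bullet> y')) * ((Y \<omega> \<bullet> z) * (Y \<omega> \<bullet> z')))
      = ?c * (\<integral>v. mass * (\<rho>\<^sup>2 * ?F v + a * ?G v) \<partial>\<sigma>)"
  proof (rule expectation_XY[of "\<lambda>u v. ((u \<bullet> y) * (u \<bullet> y')) * ((v \<bullet> z) * (v \<bullet> z'))"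
        "(norm y * norm y') * (norm z * norm z')"])
    show "\<bar>((u \<bullet> y) * (u \<bullet> y')) * ((v \<bullet> z) * (v \<bullet> z'))\<bar> \<le> (norm y * norm y') * (norm z * norm z')"
      if "norm u = 1" "norm v = 1" for u v
      unfolding abs_mult using that by (intro mult_mono S.unit_inner_le mult_nonneg_nonneg) auto
    show "(\<integral>u. kernel u v * (((u \<bullet> y) * (u \<bullet> y')) * ((v \<bullet> z) * (v \<bullet> z'))) \<partial>\<sigma>)
        = mass * (\<rho>\<^sup>2 * ?F v + a * ?G v)" if "norm v = 1" for v
    proof -
      have "(\<integral>u. kernel u v * (((u \<bullet> y) * (u \<bullet> y')) * ?G v) \<partial>\<sigma>)
          = (\<integral>u. (kernel u v * ((u \<bullet> y) * (u \<bullet> y'))) * ?G v \<partial>\<sigma>)"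
        by (simp only: mult.assoc)
      also have "\<dots> = (\<integral>u. kernel u v * ((u \<bullet> y) * (u \<bullet> y')) \<partial>\<sigma>) * ?G v"
        by (rule Bochner_Integration.integral_mult_left_zero)
      finally show ?thesis
        unfolding kernel_moments(3)[OF that] a_def[symmetric] by (simp add: inner_commute[of v] algebra_simps)
    qed
  qed measurable
  also have "(\<integral>v. mass * (\<rho>\<^sup>2 * ?F v + a * ?G v) \<partial>\<sigma>)
      = mass * (\<rho>\<^sup>2 * (\<integral>v. ?F v \<partial>\<sigma>) + a * (\<integral>v. ?G v \<partial>\<sigma>))"
  proof -
    have "integrable \<sigma> ?G"
      by (rule S.integrable_sphere[of _ "norm z * norm z'"]) (auto simp: abs_mult intro!: mult_mono S.unit_inner_le)
    then show ?thesis using S.fourth_moment_integrable[of ?q ?q' z z'] by simp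
  qed
  also have "(\<integral>v. ?F v \<partial>\<sigma>) = ((y \<bullet> y') * (z \<bullet> z') + (?q \<bullet> z) * (?q' \<bullet> z') + (?q \<bullet> z') * (?q' \<bullet> z))
      * (S.total / (?d * (?d + 2)))"
    unfolding S.fourth_moment by (simp add: inner_Q_Q)
  also have "(\<integral>v. ?G v \<partial>\<sigma>) = (z \<bullet> z') * S.total / ?d"
    unfolding S.second_moment by simp
  finally show ?thesis
    unfolding factor normalisation by (simp add: inner_Q a_def power2_eq_square)
qed

definition summand :: "'s \<Rightarrow> real^('d \<times> 'd)" where
  "summand \<omega> = gvec (real CARD('d) *\<^sub>R outer (X \<omega>) (Y \<omega>)) - gvec (\<rho> *\<^sub>R Q)"

abbreviation coord_prod :: "'d \<times> 'd \<Rightarrow> 's \<Rightarrow> real" where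
  "coord_prod p \<omega> \<equiv> (X \<omega> \<bullet> axis (fst p) 1) * (Y \<omega> \<bullet> axis (snd p) 1)"

lemma summand_nth: "summand \<omega> $ p = CARD('d) * coord_prod p \<omega> - \<rho> * Q $ fst p $ snd p"
  by (simp add: summand_def gvec_def outer_def inner_axis)

lemma axis_Q_axis: "axis i 1 \<bullet> (Q *v axis k 1) = Q $ i $ k"
  by (simp add: inner_axis' matrix_vector_mult_basis column_def)

lemma coord_prod_integrable: "integrable M (coord_prod p)" "integrable M (\<lambda>\<omega>. coord_prod p \<omega> * coord_prod q \<omega>)"
proof -
  show "integrable M (coord_prod p)" by (rule integrable_monomials(1))
  show "integrable M (\<lambda>\<omega>. coord_prod p \<omega> * coord_prod q \<omega>)"
    using integrable_monomials(2)[of "axis (fst p) 1" "axis (fst q) 1" "axis (snd p) 1" "axis (snd q) 1"]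
    by (simp only: mult_ac)
qed

lemma summand_integrable: "integrable M (\<lambda>\<omega>. summand \<omega> $ p)"
  unfolding summand_nth using coord_prod_integrable by simp

lemma summand_mean: "expectation (\<lambda>\<omega>. summand \<omega> $ p) = 0"
  unfolding summand_nth using coord_prod_integrable by (simp add: prob_space first_moment axis_Q_axis)

lemma summand_mult: "summand \<omega> $ p * summand \<omega> $ q = (CARD('d))\<^sup>2 * (coord_prod p \<omega> * coord_prod q \<omega>)
    - (CARD('d) * (\<rho> * Q $ fst q $ snd q)) * coord_prod p \<omega>
    - (CARD('d) * (\<rho> * Q $ fst p $ snd p)) * coord_prod q \<omega>
    + (\<rho> * Q $ fst p $ snd p) * (\<rho> * Q $ fst q $ snd q)"
  unfolding summand_nth by (simp add: power2_eq_square algebra_simps)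

lemma summand_mult_integrable: "integrable M (\<lambda>\<omega>. summand \<omega> $ p * summand \<omega> $ q)"
  unfolding summand_mult using coord_prod_integrable
  by (intro Bochner_Integration.integrable_add Bochner_Integration.integrable_diff integrable_mult_right) auto

lemma summand_cov: "expectation (\<lambda>\<omega>. summand \<omega> $ p * summand \<omega> $ q) = Sigma_mat \<rho> Q $ p $ q"
proof -
  obtain i k i' k' where pq: "p = (i, k)" "q = (i', k')" by (cases p, cases q) auto
  let ?d = "real CARD('d)"
  have d: "?d \<ge> 2" using dim2 by simp
  have E1: "expectation (coord_prod p) = \<rho> / ?d * Q $ fst p $ snd p" for p
    by (simp add: first_moment axis_Q_axis)
  have "expectation (\<lambda>\<omega>. coord_prod p \<omega> * coord_prod q \<omega>) = expectation (\<lambda>\<omega>. ((X \<omega> \<bullet> axis i 1) * (X \<omega> \<bullet> axis i' 1)) * ((Y \<omega> \<bullet> axis k 1) * (Y \<omega> \<bullet> axis k' 1)))"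
    by (simp only: pq fst_conv snd_conv mult_ac)
  also have "\<dots> = \<rho>\<^sup>2 / (?d * (?d + 2)) * (of_bool (p = q) + Q $ i $ k * Q $ i' $ k' + Q $ i $ k' * Q $ i' $ k)
      + (1 - \<rho>\<^sup>2) / ?d\<^sup>2 * of_bool (p = q)"
    unfolding second_moment axis_Q_axis by (simp add: pq inner_axis_axis)
  finally have E2: "expectation (\<lambda>\<omega>. coord_prod p \<omega> * coord_prod q \<omega>) = \<dots>" .
  have "expectation (\<lambda>\<omega>. summand \<omega> $ p * summand \<omega> $ q)
      = ?d\<^sup>2 * expectation (\<lambda>\<omega>. coord_prod p \<omega> * coord_prod q \<omega>)
        - (?d * (\<rho> * Q $ fst q $ snd q)) * expectation (coord_prod p)
        - (?d * (\<rho> * Q $ fst p $ snd p)) * expectation (coord_prod q)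
        + (\<rho> * Q $ fst p $ snd p) * (\<rho> * Q $ fst q $ snd q)"
    unfolding summand_mult using coord_prod_integrable by (simp add: prob_space)
  also have "\<dots> = \<rho>\<^sup>2 * ?d / (?d + 2) * (of_bool (p = q) + Q $ i $ k * Q $ i' $ k' + Q $ i $ k' * Q $ i' $ k)
      + (1 - \<rho>\<^sup>2) * of_bool (p = q) - \<rho>\<^sup>2 * (Q $ i $ k * Q $ i' $ k')"
    unfolding E1 E2 using d by (simp add: pq divide_simps) (simp add: power2_eq_square algebra_simps)
  also have "\<dots> = Sigma_mat \<rho> Q $ p $ q"
    using d by (simp add: Sigma_mat_def pq Let_def divide_simps) (auto simp: power2_eq_square algebra_simps)
  finally show ?thesis .
qed

end

section \<open>The estimator\<close>

lemma linear_gvec: "linear gvec"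
  by (rule linearI) (simp_all add: gvec_def vec_eq_iff)

lemma norm_gvec: "norm (gvec A) = norm A" for A :: "real^'d^'d"
proof -
  have "gvec A \<bullet> gvec A = A \<bullet> A"
    by (simp add: gvec_def inner_vec_def sum.cartesian_product case_prod_beta' flip: UNIV_Times_UNIV)
  then show ?thesis by (simp add: norm_eq_sqrt_inner)
qed

lemma gvec_rhoQ_hat:
  fixes U V :: "nat \<Rightarrow> 's \<Rightarrow> real^'d"
  assumes "n \<noteq> 0"
  shows "gvec (rhoQ_hat U V n \<omega>) - gvec A
    = (1 / real n) *\<^sub>R (\<Sum>j<n. gvec (real CARD('d) *\<^sub>R outer (U j \<omega>) (V j \<omega>)) - gvec A)"
proof -
  interpret linear "gvec :: real^'d^'d \<Rightarrow> _" by (rule linear_gvec)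
  show ?thesis
    using assms
    by (simp add: rhoQ_hat_def sum scale sum_subtractf scaleR_right_diff_distrib scaleR_sum_right
        sum_constant_scaleR del: sum_constant)
qed

lemma gvec_outer_measurable:
  fixes a :: "real^('d::finite \<times> 'd)"
  shows "(\<lambda>x. gvec (c *\<^sub>R outer (fst x) (snd x)) - a) \<in> borel_measurable (borel \<Otimes>\<^sub>M borel)"
proof -
  have "continuous_on UNIV (\<lambda>x::(real^'d) \<times> (real^'d). gvec (c *\<^sub>R outer (fst x) (snd x)) - a)"
    unfolding gvec_def outer_def by (intro continuous_intros)
  then show ?thesis by (simp add: borel_prod borel_measurable_continuous_onI)
qed

context spherical_pair
begin

lemma summand_norm_square: "(norm (summand \<omega>))\<^sup>2 = (\<Sum>p\<in>UNIV. summand \<omega> $ p * summand \<omega> $ p)"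
  by (simp add: power2_norm_eq_inner inner_vec_def)

lemma summand_norm_square_integrable: "integrable M (\<lambda>\<omega>. (norm (summand \<omega>))\<^sup>2)"
  unfolding summand_norm_square by (intro Bochner_Integration.integrable_sum summand_mult_integrable)

lemma inner_score_mean: "expectation (\<lambda>\<omega>. t \<bullet> summand \<omega>) = 0"
  using summand_integrable by (simp add: inner_vec_def summand_mean)

lemma inner_score_cov: "expectation (\<lambda>\<omega>. (t \<bullet> summand \<omega>)\<^sup>2) = t \<bullet> (Sigma_mat \<rho> Q *v t)"
proof -
  have "(t \<bullet> summand \<omega>)\<^sup>2 = (\<Sum>p\<in>UNIV. \<Sum>q\<in>UNIV. (t $ p * t $ q) * (summand \<omega> $ p * summand \<omega> $ q))" for \<omega>
    by (simp add: power2_eq_square inner_vec_def sum_product mult_ac)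
  then have "expectation (\<lambda>\<omega>. (t \<bullet> summand \<omega>)\<^sup>2)
      = (\<Sum>p\<in>UNIV. \<Sum>q\<in>UNIV. (t $ p * t $ q) * Sigma_mat \<rho> Q $ p $ q)"
    using summand_mult_integrable by (simp add: summand_cov)
  also have "\<dots> = t \<bullet> (Sigma_mat \<rho> Q *v t)"
    by (simp add: inner_vec_def matrix_vector_mult_def sum_distrib_left mult_ac)
  finally show ?thesis .
qed

lemma outer_integrable: "integrable M (\<lambda>\<omega>. outer (X \<omega>) (Y \<omega>))"
proof (rule integrable_XY[of outer "real CARD('d)"])
  have "continuous_on UNIV (\<lambda>x::(real^'d) \<times> (real^'d). outer (fst x) (snd x))"
    unfolding outer_def by (intro continuous_intros)
  then have "(\<lambda>x::(real^'d) \<times> (real^'d). outer (fst x) (snd x)) \<in> borel_measurable (borel \<Otimes>\<^sub>M borel)"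
    by (simp add: borel_prod borel_measurable_continuous_onI)
  from measurable_compose[OF measurable_Pair[OF XY_measurable] this]
  show "(\<lambda>\<omega>. outer (X \<omega>) (Y \<omega>)) \<in> borel_measurable M" by simp
  fix u v :: "real^'d" assume "norm u = 1" "norm v = 1"
  have "norm (outer u v $ i) \<le> 1" for i
  proof -
    have "outer u v $ i = (u $ i) *\<^sub>R v" by (simp add: outer_def vec_eq_iff)
    then show ?thesis using component_le_norm_cart[of u i] \<open>norm u = 1\<close> \<open>norm v = 1\<close> by simp
  qed
  then have "(\<Sum>i\<in>UNIV. norm (outer u v $ i)) \<le> (\<Sum>i\<in>(UNIV::'d set). 1)" by (intro sum_mono)
  moreover have "norm (outer u v) \<le> (\<Sum>i\<in>UNIV. norm (outer u v $ i))"
    unfolding norm_vec_def by (rule L2_set_le_sum) simp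
  ultimately show "norm (outer u v) \<le> real CARD('d)" by simp
qed

lemma outer_expectation: "expectation (\<lambda>\<omega>. outer (X \<omega>) (Y \<omega>)) = (\<rho> / CARD('d)) *\<^sub>R Q"
proof -
  have "expectation (\<lambda>\<omega>. outer (X \<omega>) (Y \<omega>)) $ i $ k = ((\<rho> / CARD('d)) *\<^sub>R Q) $ i $ k" for i k
  proof -
    have row: "integrable M (\<lambda>\<omega>. outer (X \<omega>) (Y \<omega>) $ i)"
      by (rule integrable_bounded_linear[OF bounded_linear_vec_nth outer_integrable])
    have "expectation (\<lambda>\<omega>. outer (X \<omega>) (Y \<omega>)) $ i $ k = expectation (\<lambda>\<omega>. outer (X \<omega>) (Y \<omega>) $ i) $ k"
      by (simp add: integral_bounded_linear[OF bounded_linear_vec_nth outer_integrable])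
    also have "\<dots> = expectation (\<lambda>\<omega>. outer (X \<omega>) (Y \<omega>) $ i $ k)"
      by (rule integral_bounded_linear[OF bounded_linear_vec_nth row, symmetric])
    also have "\<dots> = expectation (coord_prod (i, k))" by (simp add: outer_def inner_axis)
    finally show ?thesis by (simp add: first_moment axis_Q_axis)
  qed
  then show ?thesis by (simp add: vec_eq_iff)
qed

end

theorem theorem4:
  fixes M :: "'s measure"
    and U V :: "nat \<Rightarrow> 's \<Rightarrow> real^'d"
    and \<rho> :: real and Q :: "real^'d^'d"
  assumes "CARD('d) \<ge> 2"
    and "0 \<le> \<rho>" and "\<rho> < 1"
    and "orthogonal_matrix Q"
    and "prob_space M"
    and "prob_space.indep_vars M (\<lambda>_. borel \<Otimes>\<^sub>M borel) (\<lambda>j \<omega>. (U j \<omega>, V j \<omega>)) UNIV"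
    and "\<And>j. distributed M (sphere_surface \<Otimes>\<^sub>M sphere_surface) (\<lambda>\<omega>. (U j \<omega>, V j \<omega>))
                (\<lambda>(u, v). ennreal (cdens \<rho> Q u v))"
  shows "(\<forall>n\<ge>1. integrable M (rhoQ_hat U V n) \<and>
                (\<integral>\<omega>. rhoQ_hat U V n \<omega> \<partial>M) = \<rho> *\<^sub>R Q)
       \<and> (\<forall>\<epsilon>>0. (\<lambda>n. measure M {\<omega> \<in> space M. dist (rhoQ_hat U V n \<omega>) (\<rho> *\<^sub>R Q) > \<epsilon>})
                 \<longlonglongrightarrow> 0)
       \<and> (\<exists>N. is_normal_0 N (\<lambda>t. Sigma_mat \<rho> Q *v t) \<and>
              conv_in_distr M (\<lambda>n \<omega>. sqrt (real n) *\<^sub>R (gvec (rhoQ_hat U V n \<omega>) - gvec (\<rho> *\<^sub>R Q))) N)"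
proof -
  interpret prob_space M by fact
  have pair: "spherical_pair M \<rho> Q (U j) (V j)" for j
    by (intro spherical_pair.intro spherical_pair_axioms.intro prob_space_axioms assms)
  define F where "F x = gvec (real CARD('d) *\<^sub>R outer (fst x) (snd x)) - gvec (\<rho> *\<^sub>R Q)"
    for x :: "(real^'d) \<times> (real^'d)"
  define W where "W j \<omega> = F (U j \<omega>, V j \<omega>)" for j \<omega>
  have F: "F \<in> borel_measurable (borel \<Otimes>\<^sub>M borel)"
    unfolding F_def[abs_def] by (rule gvec_outer_measurable)
  have summand: "W j = spherical_pair.summand \<rho> Q (U j) (V j)" for j
    by (simp add: fun_eq_iff W_def F_def spherical_pair.summand_def[OF pair])
  interpret W: iid_centred M W "\<lambda>t. Sigma_mat \<rho> Q *v t"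
  proof (intro iid_centred.intro iid_centred_axioms.intro prob_space_axioms)
    show "indep_vars (\<lambda>_. borel) W UNIV"
      unfolding W_def[abs_def] by (rule indep_vars_compose2[OF assms(6)]) (rule F)
    show "distr M borel (W j) = distr M borel (W 0)" for j
    proof -
      have "distr M borel (W j) = distr (density (sphere_surface \<Otimes>\<^sub>M sphere_surface)
          (\<lambda>(u, v). ennreal (cdens \<rho> Q u v))) borel F" for j
        unfolding distributed_distr_eq_density[OF assms(7)[of j], symmetric]
        using spherical_pair.measurable_pair[OF pair F] distributed_measurable[OF assms(7)]
        by (subst distr_distr) (auto simp: W_def[abs_def] comp_def)
      then show ?thesis by simp
    qed
    show "integrable M (\<lambda>\<omega>. (norm (W 0 \<omega>))\<^sup>2)"
      unfolding summand by (rule spherical_pair.summand_norm_square_integrable[OF pair])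
    show "expectation (\<lambda>\<omega>. t \<bullet> W 0 \<omega>) = 0" for t
      unfolding summand by (rule spherical_pair.inner_score_mean[OF pair])
    show "expectation (\<lambda>\<omega>. (t \<bullet> W 0 \<omega>)\<^sup>2) = t \<bullet> (Sigma_mat \<rho> Q *v t)" for t
      unfolding summand by (rule spherical_pair.inner_score_cov[OF pair])
  qed
  have diff: "gvec (rhoQ_hat U V n \<omega>) - gvec (\<rho> *\<^sub>R Q) = (1 / real n) *\<^sub>R (\<Sum>j<n. W j \<omega>)" if "n \<noteq> 0" for n \<omega>
    using gvec_rhoQ_hat[OF that, of U V \<omega> "\<rho> *\<^sub>R Q"] by (simp add: W_def F_def)
  have "integrable M (rhoQ_hat U V n) \<and> (\<integral>\<omega>. rhoQ_hat U V n \<omega> \<partial>M) = \<rho> *\<^sub>R Q" if "n \<ge> 1" for n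
    using that spherical_pair.outer_integrable[OF pair] spherical_pair.outer_expectation[OF pair]
    by (simp add: rhoQ_hat_def[abs_def] sum_constant_scaleR del: sum_constant)
  moreover have "(\<lambda>n. measure M {\<omega> \<in> space M. dist (rhoQ_hat U V n \<omega>) (\<rho> *\<^sub>R Q) > \<epsilon>}) \<longlonglongrightarrow> 0"
    if "\<epsilon> > 0" for \<epsilon>
  proof (rule Lim_transform_eventually[OF W.weak_law[OF that]])
    have "dist (rhoQ_hat U V n \<omega>) (\<rho> *\<^sub>R Q) = norm ((1 / real n) *\<^sub>R (\<Sum>j<n. W j \<omega>))" if "n \<noteq> 0" for n \<omega>
      unfolding diff[OF that, symmetric] dist_norm norm_gvec[symmetric] by (simp add: linear_diff[OF linear_gvec])
    then show "\<forall>\<^sub>F n in sequentially. prob {\<omega> \<in> space M. norm ((1 / real n) *\<^sub>R (\<Sum>j<n. W j \<omega>)) > \<epsilon>}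
        = prob {\<omega> \<in> space M. dist (rhoQ_hat U V n \<omega>) (\<rho> *\<^sub>R Q) > \<epsilon>}"
      by (intro eventually_sequentiallyI[of 1]) simp
  qed
  moreover have "sqrt (real n) *\<^sub>R (gvec (rhoQ_hat U V n \<omega>) - gvec (\<rho> *\<^sub>R Q))
      = (1 / sqrt (real n)) *\<^sub>R (\<Sum>j<n. W j \<omega>)" for n \<omega>
  proof (cases "n = 0")
    case False
    then have "sqrt (real n) / real n = 1 / sqrt (real n)" by (simp add: field_simps)
    then show ?thesis unfolding diff[OF False] by simp
  qed simp
  ultimately show ?thesis using W.central_limit by simp
qed

end
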